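(* Suppose that $f$ is a transcendental entire function of the form $$f(z) = c z^q \prod_{n=1}^\infty \left(1 + \frac{z}{a_n}\right), \quad \text{where } c\in\mathbb{C}\setminus\{0\},\ q\in\{0,1,\ldots\},\ a_n\in\mathbb{C}, \text{ and } 0<|a_1|\leq |a_2|\leq\cdots,$$ and $f$ has genus zero. Suppose that there exist positive constants $\theta_1$ and $\theta_2$ with $0 \leq \theta_2 - \theta_1 < \pi$, and also $N_0\in\mathbb{N}$, such that $$\arg(a_n) \in [\theta_1, \theta_2] \mod 2\pi , \quad\text{for } n\geq N_0.$$ Then $\dim_H A(f) = 2$.
   Context: The function $f$ has genus zero: $\sum_n 1/|a_n|<\infty$, so the infinite product converges locally uniformly on $\mathbb{C}$. For $z\neq 0$, $\arg(z)\in(-\pi,\pi]$ is the principal argument; "$\arg(a_n)\in[\theta_1,\theta_2] \mod 2\pi$" means that $\arg(a_n)+2\pi k\in[\theta_1,\theta_2]$ for some integer $k$. The maximum modulus function is $M(r,f)=\max_{|z|=r}|f(z)|$ for $r\ge 0$, and $M^n(r,f)$ denotes the $n$-th iterate of $r\mapsto M(r,f)$ in the variable $r$; $f^n$ is the $n$-th iterate of $f$. The fast escaping set is $$A(f) = \{z : \text{there exists } \ell \in\mathbb{N} \text{ such that } |f^{n+\ell}(z)| \geq M^n(R,f) \text{ for all } n \in\mathbb{N}\},$$ where $R>0$ is any number such that $M(r,f)>r$ for $r\ge R$ (the set does not depend on the choice of $R$). $\dim_H$ denotes Hausdorff dimension. *)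

theory Defs
  imports "HOL-Complex_Analysis.Complex_Analysis"
begin

section \<open>Hausdorff dimension\<close>

text \<open>
  The contribution of a covering set is its diameter to the power \<open>s\<close>. For \<open>s = 0\<close> every
  nonempty set counts \<open>1\<close>, so that the zero-dimensional measure is the counting measure; this
  has to be said explicitly because \<open>0 powr 0 = 0\<close>.
\<close>

definition hausdorff_gauge :: "real \<Rightarrow> 'a::metric_space set \<Rightarrow> ennreal" where
  "hausdorff_gauge s U =
     (if U = {} then 0 else if s = 0 then 1 else ennreal (diameter U powr s))"

text \<open>
  Boundedness of the covering sets is required separately because \<^const>\<open>diameter\<close> is a
  real-valued supremum, with no meaningful value on unbounded sets. Finite covers are included,
  since the \<open>U i\<close> may be empty.
\<close>

definition hausdorff_content :: "real \<Rightarrow> real \<Rightarrow> 'a::metric_space set \<Rightarrow> ennreal" where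
  "hausdorff_content s \<delta> A =
     (INF U \<in> {U :: nat \<Rightarrow> 'a set.
                  A \<subseteq> (\<Union>i. U i) \<and> (\<forall>i. bounded (U i) \<and> diameter (U i) \<le> \<delta>)}.
        \<Sum>i. hausdorff_gauge s (U i))"

definition hausdorff_measure :: "real \<Rightarrow> 'a::metric_space set \<Rightarrow> ennreal" where
  "hausdorff_measure s A = (SUP \<delta> \<in> {0<..}. hausdorff_content s \<delta> A)"

definition hausdorff_dim :: "'a::metric_space set \<Rightarrow> ereal" where
  "hausdorff_dim A = (INF s \<in> {s. 0 \<le> s \<and> hausdorff_measure s A = 0}. ereal s)"


section \<open>Entire functions and the fast escaping set\<close>

definition transcendental_entire :: "(complex \<Rightarrow> complex) \<Rightarrow> bool" where
  "transcendental_entire f \<longleftrightarrow> f holomorphic_on UNIV \<and> \<not> (\<exists>p. \<forall>z. f z = poly p z)"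

text \<open>
  For continuous \<open>f\<close> and \<open>r \<ge> 0\<close> the circle is compact and nonempty, so this supremum is a
  maximum.
\<close>

definition max_modulus :: "(complex \<Rightarrow> complex) \<Rightarrow> real \<Rightarrow> real" where
  "max_modulus f r = (SUP z \<in> sphere 0 r. norm (f z))"

definition admissible_radius :: "(complex \<Rightarrow> complex) \<Rightarrow> real \<Rightarrow> bool" where
  "admissible_radius f R \<longleftrightarrow> 0 < R \<and> (\<forall>r\<ge>R. r < max_modulus f r)"

definition fast_escaping_wrt :: "real \<Rightarrow> (complex \<Rightarrow> complex) \<Rightarrow> complex set" where
  "fast_escaping_wrt R f =
     {z. \<exists>l. \<forall>n. (max_modulus f ^^ n) R \<le> norm ((f ^^ (n + l)) z)}"

text \<open>
  The existential quantifier over the radius stands for an arbitrary choice: by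
  \<open>fast_escaping_set_eq\<close> below, every admissible radius gives the same set.
\<close>

definition fast_escaping_set :: "(complex \<Rightarrow> complex) \<Rightarrow> complex set" where
  "fast_escaping_set f = (\<Union>R \<in> {R. admissible_radius f R}. fast_escaping_wrt R f)"


subsection \<open>Independence of the radius\<close>

lemma norm_le_max_modulus:
  assumes "f holomorphic_on UNIV" and "norm z = r"
  shows "norm (f z) \<le> max_modulus f r"
proof -
  have "continuous_on (sphere 0 r) (\<lambda>z. norm (f z))"
    using assms(1) by (intro continuous_intros)
      (meson continuous_on_subset holomorphic_on_imp_continuous_on subset_UNIV)
  then have "bdd_above ((\<lambda>z. norm (f z)) ` sphere 0 r)"
    by (intro bounded_imp_bdd_above compact_imp_bounded compact_continuous_image) auto
  then show ?thesis
    unfolding max_modulus_def using assms(2) by (intro cSUP_upper) auto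
qed

lemma max_modulus_le:
  assumes "0 \<le> r" and "\<And>z. norm z = r \<Longrightarrow> norm (f z) \<le> B"
  shows "max_modulus f r \<le> B"
  unfolding max_modulus_def using assms by (intro cSUP_least) auto

lemma norm_le_max_modulus_disc:
  assumes f: "f holomorphic_on UNIV" and r: "norm z \<le> r"
  shows "norm (f z) \<le> max_modulus f r"
proof (rule maximum_modulus_frontier[of f "cball 0 r"])
  show "f holomorphic_on interior (cball 0 r)"
    using f holomorphic_on_subset by blast
  show "continuous_on (closure (cball 0 r)) f"
    using f by (meson continuous_on_subset holomorphic_on_imp_continuous_on subset_UNIV)
  show "norm (f w) \<le> max_modulus f r" if "w \<in> frontier (cball 0 r)" for w
    using that f by (intro norm_le_max_modulus) (auto split: if_splits)
qed (use r in auto)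

lemma max_modulus_mono:
  assumes "f holomorphic_on UNIV" "0 \<le> r" "r \<le> s"
  shows "max_modulus f r \<le> max_modulus f s"
  using assms by (intro max_modulus_le norm_le_max_modulus_disc) auto

lemma max_modulus_iterate_ge:
  assumes "admissible_radius f R"
  shows "R \<le> (max_modulus f ^^ n) R"
  using assms by (induction n) (force simp: admissible_radius_def)+

lemma max_modulus_iterate_mono:
  assumes f: "f holomorphic_on UNIV" and R: "admissible_radius f R" and "R \<le> S"
  shows "(max_modulus f ^^ n) R \<le> (max_modulus f ^^ n) S"
proof (induction n)
  case (Suc n)
  have "0 \<le> (max_modulus f ^^ n) R"
    using max_modulus_iterate_ge[OF R, of n] R by (simp add: admissible_radius_def)
  then show ?case
    using Suc max_modulus_mono[OF f] by simp
qed (use assms in auto)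

lemma max_modulus_iterate_unbounded:
  assumes f: "f holomorphic_on UNIV" and R: "admissible_radius f R"
  shows "\<exists>n. S \<le> (max_modulus f ^^ n) R"
proof (rule ccontr)
  define x where "x n = (max_modulus f ^^ n) R" for n
  assume "\<not> ?thesis"
  then have "bdd_above (range x)"
    unfolding x_def by (intro bdd_aboveI[of _ S]) (auto simp: not_le less_imp_le)
  define L where "L = (SUP n. x n)"
  have xL: "x n \<le> L" for n
    unfolding L_def using \<open>bdd_above (range x)\<close> by (intro cSUP_upper) auto
  have RL: "R \<le> L"
    using xL[of 0] by (simp add: x_def)
  have *: "norm (f z) \<le> L" if "z \<in> ball 0 L" for z
  proof -
    have "\<exists>n. norm z < x n"
      using that \<open>bdd_above (range x)\<close> unfolding L_def by (auto simp: less_cSUP_iff)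
    then obtain n where "norm z < x n" ..
    then have "norm (f z) \<le> max_modulus f (x n)"
      using f by (intro norm_le_max_modulus_disc) auto
    also have "\<dots> = x (Suc n)" by (simp add: x_def)
    also have "\<dots> \<le> L" by (rule xL)
    finally show ?thesis .
  qed
  have "0 < L"
    using R RL by (simp add: admissible_radius_def)
  have "norm (f z) \<le> L" if "norm z = L" for z
  proof (rule continuous_on_closure_norm_le[of "ball 0 L" f])
    show "continuous_on (closure (ball 0 L)) f"
      using f by (meson continuous_on_subset holomorphic_on_imp_continuous_on subset_UNIV)
  qed (use * that \<open>0 < L\<close> in auto)
  then have "max_modulus f L \<le> L"
    using \<open>0 < L\<close> by (intro max_modulus_le) auto
  then show False
    using R RL by (force simp: admissible_radius_def)
qed

lemma fast_escaping_wrt_indep: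
  assumes f: "f holomorphic_on UNIV" and R: "admissible_radius f R" and S: "admissible_radius f S"
  shows "fast_escaping_wrt R f \<subseteq> fast_escaping_wrt S f"
proof
  fix z assume "z \<in> fast_escaping_wrt R f"
  then obtain l where l: "\<And>n. (max_modulus f ^^ n) R \<le> norm ((f ^^ (n + l)) z)"
    by (auto simp: fast_escaping_wrt_def)
  obtain m where m: "S \<le> (max_modulus f ^^ m) R"
    using max_modulus_iterate_unbounded[OF f R] by blast
  have "(max_modulus f ^^ n) S \<le> norm ((f ^^ (n + (m + l))) z)" for n
  proof -
    have "(max_modulus f ^^ n) S \<le> (max_modulus f ^^ n) ((max_modulus f ^^ m) R)"
      by (rule max_modulus_iterate_mono[OF f S m])
    also have "\<dots> = (max_modulus f ^^ (n + m)) R"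
      by (simp add: funpow_add)
    also have "\<dots> \<le> norm ((f ^^ (n + m + l)) z)"
      by (rule l)
    finally show ?thesis by (simp add: add.assoc)
  qed
  then show "z \<in> fast_escaping_wrt S f"
    by (auto simp: fast_escaping_wrt_def)
qed

lemma fast_escaping_set_eq:
  assumes "f holomorphic_on UNIV" and "admissible_radius f R"
  shows "fast_escaping_set f = fast_escaping_wrt R f"
  using assms fast_escaping_wrt_indep[of f] unfolding fast_escaping_set_def by blast

end

(*
  In the coordinate t = log z, with phi the bisecting direction of the sector containing the a_n,
  the function lifts on a thin half strip around Im t = phi to F = log (f (exp t)). There each
  w = exp t / a_n lies in a sector strictly inside the right half-plane, so the terms w / (1 + w)
  of F' do not cancel, |F'| tends to infinity and F'' / F' stays bounded; hence F is nearly linear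
  on balls of a fixed radius rho. Modulo 2 pi i, the image of such a ball covers about |F'|^2 balls
  of the same kind, while covering sets are expanded by about |F'|. For s < 2 this yields, by
  induction on the level, a uniform lower bound for the s-dimensional content of the points
  whose orbits stay in these balls. Such points escape fast: moving outwards by a constant factor K
  in the sector compensates for |1 + w| < 1 + |w| in every factor, so |f(z)| >= M(|z| / K) there,
  and a constant factor in the radius is absorbed by the superpolynomial growth of M.
*)
theory Submission
  imports Defs
begin

section \<open>Hausdorff measure\<close>

text \<open>The distortion of the lift costs a fixed factor at each level and would ruin a bound
  that is multiplied from level to level. It does not accumulate: an exponent below 2 gains the
  power \<open>2 - s\<close> of the expansion, and once \<open>s\<close> is fixed, the expansion is
  made large enough by starting far to the right. The sets of starting points therefore depend on
  \<open>s\<close>, and the constant in the content bound is the loss of one step only. No measure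
  is put on the limit set. Finite covers are estimated at each level, and compactness leads to
  countable covers of the intersection. The lift is used only on discs about the points k + i \<phi>
  with integer k. Together with the periods of the exponential these form a lattice of spacing at
  least 1, so counting discs in an image is counting lattice points. The finitely many factors
  without control of the argument behave like a monomial far to the right.\<close>

lemma hausdorff_gauge_eq_powr:
  assumes "s > 0"
  shows "hausdorff_gauge s U = ennreal (diameter U powr s)"
  using assms by (simp add: hausdorff_gauge_def)

section \<open>Null contents and the upper bound 2 for subsets of the plane\<close>

lemma hausdorff_content_eq_0_cover:
  fixes A :: "'a::metric_space set"
  assumes "hausdorff_content s \<delta> A = 0" and "0 < e"
  shows "\<exists>U :: nat \<Rightarrow> 'a set. A \<subseteq> (\<Union>i. U i) \<and> (\<forall>i. bounded (U i) \<and> diameter (U i) \<le> \<delta>) \<and>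
    (\<Sum>i. hausdorff_gauge s (U i)) < e"
proof -
  have "hausdorff_content s \<delta> A < e"
    using assms by simp
  then show ?thesis
    unfolding hausdorff_content_def INF_less_iff by blast
qed

lemma hausdorff_content_UN_eq_0:
  fixes A :: "nat \<Rightarrow> 'a::metric_space set"
  assumes "\<And>n. hausdorff_content s \<delta> (A n) = 0"
  shows "hausdorff_content s \<delta> (\<Union>n. A n) = 0"
proof -
  have *: "hausdorff_content s \<delta> (\<Union>n. A n) \<le> 0 + ennreal e" if "e > 0" for e :: real
  proof -
    have "\<exists>U. A n \<subseteq> (\<Union>i. U i) \<and> (\<forall>i. bounded (U i) \<and> diameter (U i) \<le> \<delta>) \<and>
            (\<Sum>i. hausdorff_gauge s (U i)) < ennreal (e * (1/2) ^ Suc n)" for n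
      using that by (intro hausdorff_content_eq_0_cover[OF assms]) simp
    then obtain U where U: "\<And>n. A n \<subseteq> (\<Union>i. U n i)" "\<And>n i. bounded (U n i)" "\<And>n i. diameter (U n i) \<le> \<delta>"
        "\<And>n. (\<Sum>i. hausdorff_gauge s (U n i)) < ennreal (e * (1/2) ^ Suc n)"
      by metis
    define V where "V = (\<lambda>i. case prod_decode i of (n, j) \<Rightarrow> U n j)"
    have "hausdorff_content s \<delta> (\<Union>n. A n) \<le> (\<Sum>i. hausdorff_gauge s (V i))"
      unfolding hausdorff_content_def
    proof (intro INF_lower, safe)
      fix n x assume "x \<in> A n"
      then obtain j where "x \<in> U n j"
        using U(1) by blast
      then have "x \<in> V (prod_encode (n, j))"
        by (simp add: V_def)
      then show "x \<in> \<Union> (range V)"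
        by blast
    qed (auto simp: V_def U split: prod.split)
    also have "\<dots> = (\<Sum>i. (\<lambda>(n, j). hausdorff_gauge s (U n j)) (prod_decode i))"
      by (intro arg_cong[of _ _ suminf]) (auto simp: V_def fun_eq_iff split: prod.split)
    also have "\<dots> = (\<Sum>n. \<Sum>j. hausdorff_gauge s (U n j))"
      by (rule suminf_ennreal_2dimen) auto
    also have "\<dots> \<le> (\<Sum>n. ennreal (e * (1/2) ^ Suc n))"
      using U(4) by (intro suminf_le) (auto intro: less_imp_le)
    also have "\<dots> = ennreal e"
      using sums_mult[OF power_half_series, of e] that
      by (intro suminf_ennreal_eq) auto
    finally show ?thesis
      by simp
  qed
  have "hausdorff_content s \<delta> (\<Union>n. A n) \<le> 0"
    by (rule ennreal_le_epsilon) (rule *)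
  then show ?thesis
    by simp
qed

lemma hausdorff_content_mono:
  assumes "A \<subseteq> B"
  shows "hausdorff_content s \<delta> A \<le> hausdorff_content s \<delta> B"
  unfolding hausdorff_content_def using assms by (intro INF_superset_mono) auto

text \<open>A subdivision into \<open>M * M\<close> squares of diameter at most \<open>2 / M\<close>
  costs \<open>2 powr s * M powr (2 - s)\<close>, which tends to 0 because
  \<open>s > 2\<close>.\<close>

lemma hausdorff_content_unit_square:
  fixes p q s \<delta> :: real
  assumes s: "s > 2" and \<delta>: "\<delta> > 0"
  shows "hausdorff_content s \<delta> (cbox (Complex p q) (Complex (p + 1) (q + 1))) = 0"
    (is "hausdorff_content s \<delta> ?Q = 0")
proof -
  have le: "hausdorff_content s \<delta> ?Q \<le> ennreal (2 powr s * real M powr (2 - s))"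
    if M: "M > 0" "2 / real M \<le> \<delta>" for M :: nat
  proof -
    define U where "U i = (if i < M * M then
      cbox (Complex (p + real (i div M) / M) (q + real (i mod M) / M))
        (Complex (p + real (i div M + 1) / M) (q + real (i mod M + 1) / M)) else {})" for i
    have diam: "bounded (U i) \<and> diameter (U i) \<le> 2 / M" for i
    proof
      show "bounded (U i)"
        by (simp add: U_def)
      show "diameter (U i) \<le> 2 / M"
      proof (rule diameter_le)
        fix x y assume "x \<in> U i" "y \<in> U i"
        then have "\<bar>Re (x - y)\<bar> \<le> 1 / M" "\<bar>Im (x - y)\<bar> \<le> 1 / M"
          by (auto simp: U_def in_cbox_complex_iff abs_le_iff add_divide_distrib split: if_splits)
        then show "norm (x - y) \<le> 2 / M"
          using cmod_le[of "x - y"] by linarith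
      qed simp
    qed
    have "?Q \<subseteq> (\<Union>i. U i)"
    proof
      fix z assume z: "z \<in> ?Q"
      have *: "\<exists>k<M. x + real k / M \<le> r \<and> r \<le> x + real (k + 1) / M" if r: "x \<le> r" "r \<le> x + 1" for x r :: real
      proof (cases "r = x + 1")
        \<comment> \<open>At the right end point the floor of the other case would give
          \<open>M\<close>, so the last cell has to take it.\<close>
        case True
        then show ?thesis
          using M by (intro exI[of _ "M - 1"]) (auto simp: of_nat_diff field_simps)
      next
        case False
        define k where "k = nat \<lfloor>M * (r - x)\<rfloor>"
        have k: "real k \<le> M * (r - x)" "M * (r - x) < real k + 1"
          using M r unfolding k_def by (auto intro: floor_correct)
        have "real M * (r - x) < real M * 1"
          using M r False by (intro mult_strict_left_mono) auto
        with k have "k < M"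
          by linarith
        then show ?thesis
          using M k by (intro exI[of _ k]) (auto simp: field_simps)
      qed
      obtain k l where k: "k < M" "p + real k / M \<le> Re z" "Re z \<le> p + real (k + 1) / M"
        and l: "l < M" "q + real l / M \<le> Im z" "Im z \<le> q + real (l + 1) / M"
        using *[of p "Re z"] *[of q "Im z"] z by (auto simp: in_cbox_complex_iff)
      have "k * M + l < M * M"
        using l(1) mult_le_mono1[of "Suc k" M M] k(1) by simp
      then have "z \<in> U (k * M + l)"
        using k l by (simp add: U_def in_cbox_complex_iff)
      then show "z \<in> (\<Union>i. U i)"
        by blast
    qed
    then have "hausdorff_content s \<delta> ?Q \<le> (\<Sum>i. hausdorff_gauge s (U i))"
      unfolding hausdorff_content_def using diam M(2) order_trans by (intro INF_lower) blast
    also have "\<dots> = (\<Sum>i<M * M. hausdorff_gauge s (U i))"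
      by (intro suminf_finite) (auto simp: U_def hausdorff_gauge_def)
    also have "\<dots> \<le> (\<Sum>i<M * M. ennreal ((2 / M) powr s))"
      using s diam by (intro sum_mono)
        (auto simp: hausdorff_gauge_eq_powr intro!: ennreal_leI powr_mono2 diameter_ge_0)
    also have "\<dots> = ennreal (real (M * M) * (2 / M) powr s)"
      by (simp add: ennreal_mult ennreal_of_nat_eq_real_of_nat)
    also have "real (M * M) * (2 / M) powr s = 2 powr s * real M powr (2 - s)"
      using M by (simp add: powr_divide powr_diff power2_eq_square)
    finally show ?thesis .
  qed
  have "((\<lambda>M. ennreal (2 powr s * real M powr (2 - s))) \<longlongrightarrow> ennreal (2 powr s * 0)) sequentially"
    using s by (intro tendsto_ennrealI tendsto_mult tendsto_const tendsto_neg_powr filterlim_real_sequentially) auto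
  moreover have "eventually (\<lambda>M. hausdorff_content s \<delta> ?Q \<le> ennreal (2 powr s * real M powr (2 - s))) sequentially"
    using eventually_gt_at_top[of "0::nat"] eventually_ge_at_top[of "nat \<lceil>2 / \<delta>\<rceil>"]
  proof eventually_elim
    case (elim M)
    then have "2 / \<delta> \<le> real M"
      by linarith
    then show ?case
      using elim \<delta> by (intro le) (auto simp: field_simps)
  qed
  ultimately have "hausdorff_content s \<delta> ?Q \<le> ennreal (2 powr s * 0)"
    by (rule tendsto_lowerbound) auto
  then show ?thesis
    by simp
qed

lemma hausdorff_measure_complex_eq_0:
  fixes A :: "complex set"
  assumes s: "s > 2"
  shows "hausdorff_measure s A = 0"
proof -
  have "hausdorff_content s \<delta> A = 0" if \<delta>: "\<delta> > 0" for \<delta>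
  proof -
    define Q where "Q n = (case from_nat n of (p :: int, q :: int) \<Rightarrow>
      cbox (Complex p q) (Complex (p + 1) (q + 1)))" for n :: nat
    have "A \<subseteq> (\<Union>n. Q n)"
    proof
      fix z assume "z \<in> A"
      have "z \<in> Q (to_nat (\<lfloor>Re z\<rfloor>, \<lfloor>Im z\<rfloor>))"
        by (simp add: Q_def in_cbox_complex_iff)
      then show "z \<in> (\<Union>n. Q n)"
        by blast
    qed
    then have "hausdorff_content s \<delta> A \<le> hausdorff_content s \<delta> (\<Union>n. Q n)"
      by (rule hausdorff_content_mono)
    also have "\<dots> = 0"
      using s \<delta> by (intro hausdorff_content_UN_eq_0)
        (auto simp: Q_def hausdorff_content_unit_square split: prod.split)
    finally show ?thesis
      by simp
  qed
  then show ?thesis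
    by (auto simp: hausdorff_measure_def SUP_eq_const)
qed

lemma hausdorff_dim_complex_le_2:
  fixes A :: "complex set"
  shows "hausdorff_dim A \<le> 2"
proof (rule ereal_le_epsilon2)
  fix e :: real assume "e > 0"
  then show "hausdorff_dim A \<le> 2 + ereal e"
    unfolding hausdorff_dim_def
    by (intro INF_lower2[of "2 + e"]) (auto simp: hausdorff_measure_complex_eq_0 numeral_eq_ereal)
qed

text \<open>The infimum in \<open>hausdorff_dim\<close> admits \<open>s = 0\<close>, which has to be
  excluded separately: any cover of \<open>A\<close> has a nonempty member, of gauge 1.\<close>

lemma hausdorff_measure_0_neq_0:
  assumes "A \<noteq> {}"
  shows "hausdorff_measure 0 A \<noteq> 0"
proof
  assume 0: "hausdorff_measure 0 A = 0"
  have "hausdorff_content 0 1 A \<le> hausdorff_measure 0 A"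
    unfolding hausdorff_measure_def by (rule SUP_upper) auto
  with 0 have "hausdorff_content 0 1 A = 0"
    by simp
  then obtain U :: "nat \<Rightarrow> 'a set"
    where U: "A \<subseteq> (\<Union>i. U i)" "(\<Sum>i. hausdorff_gauge 0 (U i)) < 1"
    using hausdorff_content_eq_0_cover[OF _ zero_less_one] by blast
  obtain i where "U i \<noteq> {}"
    using U(1) assms by blast
  with ennreal_suminf_lessD[OF U(2), of i] show False
    by (simp add: hausdorff_gauge_def)
qed

lemma hausdorff_measure_empty: "hausdorff_measure s {} = 0"
proof -
  have "hausdorff_content s \<delta> ({} :: 'a set) \<le> (\<Sum>i. hausdorff_gauge s ({} :: 'a set))" if "\<delta> > 0" for \<delta>
    unfolding hausdorff_content_def using that by (intro INF_lower2[of "\<lambda>_. {}"]) auto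
  then show ?thesis
    by (auto simp: hausdorff_measure_def hausdorff_gauge_def SUP_eq_const)
qed

lemma hausdorff_dim_eq_2I:
  fixes A :: "complex set"
  assumes "\<And>s. 0 < s \<Longrightarrow> s < 2 \<Longrightarrow> hausdorff_measure s A \<noteq> 0"
  shows "hausdorff_dim A = 2"
proof (rule antisym)
  have "A \<noteq> {}"
    using assms[of 1] hausdorff_measure_empty by auto
  then have "hausdorff_measure 0 A \<noteq> 0"
    by (rule hausdorff_measure_0_neq_0)
  then have "2 \<le> s" if "0 \<le> s" "hausdorff_measure s A = 0" for s
    using that assms[of s] by (cases "s = 0") force+
  then show "2 \<le> hausdorff_dim A"
    unfolding hausdorff_dim_def by (intro INF_greatest) (auto simp: numeral_eq_ereal)
qed (rule hausdorff_dim_complex_le_2)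

section \<open>Lower bounds for the measure of a nested intersection of compact sets\<close>

text \<open>This takes the place of a mass distribution. The covering sets are enlarged to open ones
  at total cost \<open>e\<close>; these cover some \<open>K n\<close> entirely, finitely many of
  them suffice, and the bound for finite covers applies.\<close>

lemma suminf_gauge_ge_of_compact_approx:
  fixes K :: "nat \<Rightarrow> 'a::euclidean_space set"
  assumes s: "s > 0"
    and K: "\<And>n. compact (K n)" "\<And>n. K (Suc n) \<subseteq> K n"
    and fin: "\<And>n (I :: nat set) U. finite I \<Longrightarrow> (\<And>i. i \<in> I \<Longrightarrow> bounded (U i)) \<Longrightarrow> K n \<subseteq> (\<Union>i\<in>I. U i) \<Longrightarrow>
            c \<le> (\<Sum>i\<in>I. diameter (U i) powr s)"
    and U: "(\<Inter>n. K n) \<subseteq> (\<Union>i. U i)" "\<And>i. bounded (U i)"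
  shows "ennreal c \<le> (\<Sum>i. hausdorff_gauge s (U i))"
proof (cases "(\<Sum>i. hausdorff_gauge s (U i)) = top")
  case False
  then have sm: "summable (\<lambda>i. diameter (U i) powr s)"
    using s by (intro summable_suminf_not_top) (auto simp: hausdorff_gauge_eq_powr)
  have "c \<le> (\<Sum>i. diameter (U i) powr s) + e" if e: "e > 0" for e
  proof -
    \<comment> \<open>Continuity of the power at \<open>diameter (U i)\<close>, which may be 0, uses
      \<open>s > 0\<close>.\<close>
    have "\<exists>\<epsilon>>0. (diameter (U i) + 2 * \<epsilon>) powr s \<le> diameter (U i) powr s + e * (1/2) ^ Suc i" for i
    proof -
      have d0: "diameter (U i) \<ge> 0"
        using U by (intro diameter_ge_0)
      have "((\<lambda>\<epsilon>. (diameter (U i) + 2 * \<epsilon>) powr s) \<longlongrightarrow> (diameter (U i) + 2 * 0) powr s) (at_right 0)"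
        using s d0 by (intro tendsto_powr' tendsto_intros)
          (auto simp: eventually_at_filter intro!: always_eventually)
      then have "eventually (\<lambda>\<epsilon>. (diameter (U i) + 2 * \<epsilon>) powr s < diameter (U i) powr s + e * (1/2) ^ Suc i) (at_right 0)"
        using e by (intro order_tendstoD(2)) auto
      then have "eventually (\<lambda>\<epsilon>. (diameter (U i) + 2 * \<epsilon>) powr s < diameter (U i) powr s + e * (1/2) ^ Suc i \<and> \<epsilon> > 0) (at_right 0)"
        by (intro eventually_conj) (auto simp: eventually_at_filter)
      then show ?thesis
        using eventually_happens by (fastforce intro: less_imp_le)
    qed
    then obtain \<epsilon> where \<epsilon>: "\<And>i. \<epsilon> i > 0"
      "\<And>i. (diameter (U i) + 2 * \<epsilon> i) powr s \<le> diameter (U i) powr s + e * (1/2) ^ Suc i"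
      by metis
    define V where "V i = (\<Union>x\<in>U i. ball x (\<epsilon> i))" for i
    have dV: "dist x y \<le> diameter (U i) + 2 * \<epsilon> i" if xy: "x \<in> V i" "y \<in> V i" for x y i
    proof -
      obtain u v where uv: "u \<in> U i" "v \<in> U i" "dist u x < \<epsilon> i" "dist v y < \<epsilon> i"
        using xy unfolding V_def by auto
      have "dist u v \<le> diameter (U i)"
        using uv U by (intro diameter_bounded_bound) auto
      moreover have "dist x y \<le> dist u x + dist u v + dist v y"
        by (smt (verit) dist_commute dist_triangle)
      ultimately show ?thesis
        using uv by linarith
    qed
    have bV: "bounded (V i)" for i
      using dV unfolding bounded_two_points by blast
    have diamV: "diameter (V i) \<le> diameter (U i) + 2 * \<epsilon> i" for i
      using dV \<epsilon>(1)[of i] diameter_ge_0[OF U(2), of i] by (intro diameter_le) (auto simp: dist_norm)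
    have "U i \<subseteq> V i" for i
      using \<epsilon>(1) by (force simp: V_def)
    then have cov: "(\<Inter>n. K n) \<subseteq> (\<Union>i. V i)"
      by (intro order_trans[OF U(1)] UN_mono) auto
    have oV: "open (V i)" for i
      by (auto simp: V_def)
    have anti: "K n \<subseteq> K m" if "m \<le> n" for m n
      using that by (rule lift_Suc_antimono_le[of K, OF K(2)])
    obtain n where n: "K n \<subseteq> (\<Union>i. V i)"
    proof (rule ccontr)
      \<comment> \<open>Otherwise the sets \<open>K n\<close> minus the open union are compact,
        decreasing and nonempty, and have a common point that the cover misses.\<close>
      assume "\<not> thesis"
      then have "K n - (\<Union>i. V i) \<noteq> {}" for n
        using that[of n] by auto
      moreover have "compact (K n - (\<Union>i. V i))" for n
        using K(1) oV by (intro compact_diff open_UN) auto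
      ultimately have "(\<Inter>n. K n - (\<Union>i. V i)) \<noteq> {}"
        using anti by (intro compact_nest) (simp_all add: Diff_mono)
      moreover have "(\<Inter>n. K n - (\<Union>i. V i)) = (\<Inter>n. K n) - (\<Union>i. V i)"
        by simp
      ultimately show False
        using cov by simp
    qed
    obtain I where I: "finite I" "K n \<subseteq> (\<Union>i\<in>I. V i)"
      using compactE_image[OF K(1)[of n], of UNIV V] n oV by auto
    have g: "(\<lambda>i. e * (1/2) ^ Suc i) sums e"
      using sums_mult[OF power_half_series, of e] by simp
    have sm2: "summable (\<lambda>i. diameter (U i) powr s + e * (1/2) ^ Suc i)"
      using sm g by (intro summable_add) (auto simp: sums_iff)
    have "c \<le> (\<Sum>i\<in>I. diameter (V i) powr s)"
      by (rule fin[OF I(1) bV I(2)])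
    also have "\<dots> \<le> (\<Sum>i\<in>I. diameter (U i) powr s + e * (1/2) ^ Suc i)"
      using \<epsilon>(2) powr_mono2[OF less_imp_le[OF s] diameter_ge_0[OF bV] diamV]
      by (intro sum_mono) (rule order_trans)
    also have "\<dots> \<le> (\<Sum>i. diameter (U i) powr s + e * (1/2) ^ Suc i)"
      using sm2 I(1) e by (intro sum_le_suminf) auto
    also have "\<dots> = (\<Sum>i. diameter (U i) powr s) + e"
      using sm g by (subst suminf_add[symmetric]) (auto simp: sums_iff)
    finally show ?thesis .
  qed
  then have "c \<le> (\<Sum>i. diameter (U i) powr s)"
    by (rule field_le_epsilon)
  then show ?thesis
    using s sm by (simp add: hausdorff_gauge_eq_powr suminf_ennreal2 ennreal_leI)
qed auto

text \<open>A cover of \<open>A\<close> is pulled back through \<open>g\<close> to a cover of the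
  intersection, at the cost of a factor \<open>L\<close> in the diameters. Later \<open>g\<close> is
  the exponential, which leads from the strip back to the plane.\<close>

lemma hausdorff_measure_neq_0_of_compact_approx:
  fixes K :: "nat \<Rightarrow> 'a::euclidean_space set" and g :: "'a \<Rightarrow> 'b::metric_space"
  assumes s: "s > 0" and c: "c > 0"
    and K: "\<And>n. compact (K n)" "\<And>n. K (Suc n) \<subseteq> K n"
    and fin: "\<And>n (I :: nat set) U. finite I \<Longrightarrow> (\<And>i. i \<in> I \<Longrightarrow> bounded (U i)) \<Longrightarrow> K n \<subseteq> (\<Union>i\<in>I. U i) \<Longrightarrow>
            c \<le> (\<Sum>i\<in>I. diameter (U i) powr s)"
    and g: "\<And>x. x \<in> (\<Inter>n. K n) \<Longrightarrow> g x \<in> A"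
    and L: "L > 0" "\<And>x y. x \<in> (\<Inter>n. K n) \<Longrightarrow> y \<in> (\<Inter>n. K n) \<Longrightarrow> dist x y \<le> L * dist (g x) (g y)"
  shows "hausdorff_measure s A \<noteq> 0"
proof
  assume 0: "hausdorff_measure s A = 0"
  have "hausdorff_content s 1 A \<le> hausdorff_measure s A"
    unfolding hausdorff_measure_def by (rule SUP_upper) auto
  with 0 have "hausdorff_content s 1 A = 0"
    by simp
  moreover have "0 < ennreal (c / L powr s)"
    using c L by simp
  ultimately obtain U :: "nat \<Rightarrow> 'b set"
    where U: "A \<subseteq> (\<Union>i. U i)" "\<And>i. bounded (U i)"
      "(\<Sum>i. hausdorff_gauge s (U i)) < ennreal (c / L powr s)"
    using hausdorff_content_eq_0_cover[of s 1 A "ennreal (c / L powr s)"] by auto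
  define W where "W i = {x \<in> \<Inter>n. K n. g x \<in> U i}" for i
  have dW: "dist x y \<le> L * diameter (U i)" if "x \<in> W i" "y \<in> W i" for x y i
  proof -
    have "dist x y \<le> L * dist (g x) (g y)"
      using that by (intro L) (auto simp: W_def)
    also have "\<dots> \<le> L * diameter (U i)"
      using that U L by (intro mult_left_mono diameter_bounded_bound) (auto simp: W_def)
    finally show ?thesis .
  qed
  have bW: "bounded (W i)" for i
    using dW unfolding bounded_two_points by blast
  have diamW: "diameter (W i) \<le> L * diameter (U i)" for i
    using dW L diameter_ge_0[OF U(2), of i] by (intro diameter_le) (auto simp: dist_norm)
  have "ennreal c \<le> (\<Sum>i. hausdorff_gauge s (W i))"
  proof (rule suminf_gauge_ge_of_compact_approx[where K = K])
    show "(\<Inter>n. K n) \<subseteq> (\<Union>i. W i)"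
      using g U(1) by (fastforce simp: W_def)
    show "c \<le> (\<Sum>i\<in>I. diameter (V i) powr s)"
      if "finite I" "\<And>i. i \<in> I \<Longrightarrow> bounded (V i)" "K n \<subseteq> (\<Union>i\<in>I. V i)" for n and I :: "nat set" and V
      by (rule fin[OF that])
  qed (rule s K bW)+
  also have "\<dots> \<le> (\<Sum>i. ennreal (L powr s) * hausdorff_gauge s (U i))"
  proof (intro suminf_le)
    fix i
    have "diameter (W i) powr s \<le> (L * diameter (U i)) powr s"
      using s diamW diameter_ge_0[OF bW] by (intro powr_mono2) auto
    also have "\<dots> = L powr s * diameter (U i) powr s"
      by (rule powr_mult)
    finally show "hausdorff_gauge s (W i) \<le> ennreal (L powr s) * hausdorff_gauge s (U i)"
      using s by (simp add: hausdorff_gauge_eq_powr ennreal_mult[symmetric] ennreal_leI)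
  qed simp_all
  also have "\<dots> = ennreal (L powr s) * (\<Sum>i. hausdorff_gauge s (U i))"
    by simp
  also have "\<dots> < ennreal (L powr s) * ennreal (c / L powr s)"
    using U(3) L by (intro ennreal_mult_strict_left_mono) auto
  also have "\<dots> = ennreal c"
    using L c by (simp add: ennreal_mult[symmetric])
  finally show False
    by simp
qed

section \<open>Limit sets of expanding maps of a strip\<close>

text \<open>Newton's iteration with fixed slope, \<open>t - (F t - v) / A\<close>, is a contraction
  with constant 1/2. For a target within \<open>norm A * \<rho> / 2\<close> of \<open>F y\<close> it
  moves the centre by at most half the radius, so it maps the disc into itself.\<close>

lemma near_linear_surj:
  fixes F :: "complex \<Rightarrow> complex"
  assumes \<rho>: "\<rho> \<ge> 0" and A: "A \<noteq> 0"
    and lin: "\<And>t u. t \<in> cball y \<rho> \<Longrightarrow> u \<in> cball y \<rho> \<Longrightarrow>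
            norm (F t - F u - A * (t - u)) \<le> 1/2 * norm A * norm (t - u)"
    and v: "v \<in> cball (F y) (norm A * \<rho> / 2)"
  shows "\<exists>t\<in>cball y \<rho>. F t = v"
proof -
  define g where "g t = t - (F t - v) / A" for t
  have g: "norm (g t - g u) \<le> 1/2 * norm (t - u)" if "t \<in> cball y \<rho>" "u \<in> cball y \<rho>" for t u
  proof -
    have "g t - g u = - (F t - F u - A * (t - u)) / A"
      using A by (simp add: g_def field_simps)
    then have "norm (g t - g u) = norm (F t - F u - A * (t - u)) / norm A"
      by (simp add: norm_divide norm_minus_commute)
    also have "\<dots> \<le> 1/2 * norm A * norm (t - u) / norm A"
      using lin[OF that] by (intro divide_right_mono) auto
    finally show ?thesis
      using A by simp
  qed
  have yy: "y \<in> cball y \<rho>"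
    using \<rho> by simp
  have "\<exists>!t\<in>cball y \<rho>. g t = t"
  proof (rule Banach_fix[where c = "1/2"])
    show "g ` cball y \<rho> \<subseteq> cball y \<rho>"
    proof safe
      fix t assume t: "t \<in> cball y \<rho>"
      have "norm (g y - y) = norm (F y - v) / norm A"
        by (simp add: g_def norm_divide norm_minus_commute)
      also have "\<dots> \<le> \<rho> / 2"
        using v A by (simp add: dist_norm field_simps)
      finally have "norm (g y - y) \<le> \<rho> / 2" .
      moreover have "norm (g t - g y) \<le> \<rho> / 2"
        using g[OF t yy] t by (simp add: dist_norm norm_minus_commute)
      ultimately have "norm (g t - y) \<le> \<rho>"
        using norm_triangle_ineq[of "g t - g y" "g y - y"] by simp
      then show "g t \<in> cball y \<rho>"
        by (simp add: dist_norm norm_minus_commute)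
    qed
  qed (use \<rho> g in \<open>auto simp: dist_norm complete_eq_closed\<close>)
  then obtain t where "t \<in> cball y \<rho>" "g t = t"
    by blast
  then show ?thesis
    using A by (auto simp: g_def intro!: bexI[of _ t])
qed

lemma card_int_interval_ge: "real (card {\<lceil>a\<rceil>..\<lfloor>b\<rfloor>}) \<ge> b - a - 1" for a b :: real
proof -
  have "b - a - 1 \<le> real_of_int (\<lfloor>b\<rfloor> - \<lceil>a\<rceil> + 1)"
    by linarith
  also have "\<dots> \<le> real (nat (\<lfloor>b\<rfloor> - \<lceil>a\<rceil> + 1))"
    by linarith
  finally show ?thesis
    by (simp add: algebra_simps)
qed

lemma card_int_pairs_le:
  fixes S :: "(int \<times> int) set"
  assumes L: "L \<ge> 0"
    and S: "\<And>j m j' m'. (j, m) \<in> S \<Longrightarrow> (j', m') \<in> S \<Longrightarrow> \<bar>real_of_int (j - j')\<bar> \<le> L \<and> \<bar>real_of_int (m - m')\<bar> \<le> L"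
  shows "real (card S) \<le> (2 * L + 1)\<^sup>2"
proof (cases "S = {}")
  case False
  then obtain j m where jm: "(j, m) \<in> S"
    by auto
  define T where "T = {j - \<lfloor>L\<rfloor>..j + \<lfloor>L\<rfloor>} \<times> {m - \<lfloor>L\<rfloor>..m + \<lfloor>L\<rfloor>}"
  have "S \<subseteq> T"
  proof
    fix p assume p: "p \<in> S"
    obtain j' m' where [simp]: "p = (j', m')"
      by (cases p)
    have "\<bar>real_of_int (j - j')\<bar> \<le> L" "\<bar>real_of_int (m - m')\<bar> \<le> L"
      using S[OF jm, of j' m'] p by auto
    then have "\<bar>j - j'\<bar> \<le> \<lfloor>L\<rfloor>" "\<bar>m - m'\<bar> \<le> \<lfloor>L\<rfloor>"
      by (simp_all add: le_floor_iff)
    then show "p \<in> T"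
      by (auto simp: T_def)
  qed
  then have "card S \<le> card T"
    by (intro card_mono) (auto simp: T_def)
  also have "card T = nat (2 * \<lfloor>L\<rfloor> + 1) * nat (2 * \<lfloor>L\<rfloor> + 1)"
    by (simp add: T_def card_cartesian_product algebra_simps)
  finally have "real (card S) \<le> real (nat (2 * \<lfloor>L\<rfloor> + 1)) * real (nat (2 * \<lfloor>L\<rfloor> + 1))"
    by (metis of_nat_le_iff of_nat_mult)
  also have "\<dots> \<le> (2 * L + 1) * (2 * L + 1)"
    using L by (intro mult_mono) linarith+
  finally show ?thesis
    by (simp add: power2_eq_square)
qed auto

text \<open>Comparison of areas: a set of diameter \<open>d\<close> lies in a disc of radius
  \<open>d\<close>, the factor \<open>pi\<close> cancels, and \<open>d^2 \<le> d powr s\<close> as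
  long as \<open>d \<le> 1\<close>. A single set of diameter above 1 is enough by itself.\<close>

lemma sum_diameter_powr_ge_of_cball_cover:
  fixes y :: complex and U :: "'i \<Rightarrow> complex set"
  assumes \<rho>: "0 < \<rho>" "\<rho> \<le> 1" and s: "0 < s" "s \<le> 2"
    and I: "finite I" and bU: "\<And>i. i \<in> I \<Longrightarrow> bounded (U i)" and cov: "cball y \<rho> \<subseteq> (\<Union>i\<in>I. U i)"
  shows "\<rho>\<^sup>2 \<le> (\<Sum>i\<in>I. diameter (U i) powr s)"
proof (cases "\<exists>i\<in>I. diameter (U i) > 1")
  case True
  then obtain i where i: "i \<in> I" "diameter (U i) > 1"
    by blast
  have "\<rho>\<^sup>2 \<le> 1"
    using \<rho> by (simp add: power_le_one)
  also have "1 \<le> diameter (U i) powr s"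
    using i s by (intro ge_one_powr_ge_zero) auto
  also have "\<dots> \<le> (\<Sum>i\<in>I. diameter (U i) powr s)"
    using I i by (intro member_le_sum) auto
  finally show ?thesis .
next
  case False
  define I' where "I' = {i \<in> I. U i \<noteq> {}}"
  have "\<forall>i\<in>I'. \<exists>x. U i \<subseteq> cball x (diameter (U i))"
  proof
    fix i assume "i \<in> I'"
    then obtain x where "x \<in> U i" "i \<in> I"
      by (auto simp: I'_def)
    then show "\<exists>x. U i \<subseteq> cball x (diameter (U i))"
      using bU by (auto intro!: exI[of _ x] diameter_bounded_bound)
  qed
  then obtain x where x: "\<And>i. i \<in> I' \<Longrightarrow> U i \<subseteq> cball (x i) (diameter (U i))"
    by metis
  have "cball y \<rho> \<subseteq> (\<Union>i\<in>I'. cball (x i) (diameter (U i)))"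
    using cov x by (fastforce simp: I'_def)
  then have "measure lborel (cball y \<rho>) \<le> measure lborel (\<Union>i\<in>I'. cball (x i) (diameter (U i)))"
    using I by (intro measure_mono_fmeasurable) (auto simp: I'_def intro!: fmeasurable.finite_UN fmeasurable_compact)
  also have "\<dots> \<le> (\<Sum>i\<in>I'. measure lborel (cball (x i) (diameter (U i))))"
    using I by (intro measure_UNION_le) (auto simp: I'_def)
  also have "\<dots> = (\<Sum>i\<in>I'. unit_ball_vol 2 * (diameter (U i))\<^sup>2)"
    using bU by (intro sum.cong) (auto simp: content_cball diameter_ge_0 I'_def)
  finally have "unit_ball_vol 2 * \<rho>\<^sup>2 \<le> unit_ball_vol 2 * (\<Sum>i\<in>I'. (diameter (U i))\<^sup>2)"
    using \<rho> by (simp add: content_cball sum_distrib_left)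
  then have "\<rho>\<^sup>2 \<le> (\<Sum>i\<in>I'. (diameter (U i))\<^sup>2)"
    by (simp add: unit_ball_vol_2)
  also have "\<dots> \<le> (\<Sum>i\<in>I'. diameter (U i) powr s)"
  proof (intro sum_mono)
    fix i assume "i \<in> I'"
    then have "0 \<le> diameter (U i)" "diameter (U i) \<le> 1"
      using False bU by (auto simp: I'_def intro: diameter_ge_0)
    then have "diameter (U i) powr 2 \<le> diameter (U i) powr s"
      using s by (intro powr_mono') auto
    then show "(diameter (U i))\<^sup>2 \<le> diameter (U i) powr s"
      using \<open>0 \<le> diameter (U i)\<close> by simp
  qed
  also have "\<dots> \<le> (\<Sum>i\<in>I. diameter (U i) powr s)"
    using I by (intro sum_mono2) (auto simp: I'_def)
  finally show ?thesis .
qed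

lemma norm_exp_minus_1_le:
  fixes w :: complex
  assumes "norm w \<le> 1/2"
  shows "norm (exp w - 1) \<le> 2 * norm w"
proof -
  have "norm (exp w - exp 0) \<le> 2 * norm (w - 0)"
  proof (rule field_differentiable_bound[where S = "cball 0 (1/2)" and f' = exp])
    fix z :: complex assume "z \<in> cball 0 (1/2)"
    then show "norm (exp z) \<le> 2"
      by (intro exp_bound_half) auto
  qed (use assms in \<open>auto intro!: derivative_eq_intros\<close>)
  then show ?thesis
    by simp
qed

text \<open>\<open>A k\<close> stands for the derivative of the lift near
  \<open>k + i \<phi>\<close>, and \<open>B\<close> bounds the expansion from below. The bound
  \<open>48 / \<rho>\<close> makes \<open>h k\<close> at least 8, so that rounding to lattice points
  loses only a constant factor. Together with the choice of \<open>J\<close>, \<open>ReF\<close>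
  prevents orbits from drifting to the left.\<close>

locale expanding_strip =
  fixes F :: "complex \<Rightarrow> complex" and \<phi> \<rho> B :: real and k0 :: int and A :: "int \<Rightarrow> complex"
  assumes \<rho>: "0 < \<rho>" "\<rho> \<le> 1/4"
    and B: "48 / \<rho> \<le> B"
    and normA: "\<And>k. k0 \<le> k \<Longrightarrow> B \<le> norm (A k)"
    and lin: "\<And>k t u. k0 \<le> k \<Longrightarrow> t \<in> cball (Complex (of_int k) \<phi>) \<rho> \<Longrightarrow> u \<in> cball (Complex (of_int k) \<phi>) \<rho> \<Longrightarrow>
            norm (F t - F u - A k * (t - u)) \<le> 1/2 * norm (A k) * norm (t - u)"
    and ReF: "\<And>k. k0 \<le> k \<Longrightarrow> of_int k \<le> Re (F (Complex (of_int k) \<phi>))"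
begin

definition y :: "int \<Rightarrow> complex" where "y k = Complex (of_int k) \<phi>"

definition shift :: "int \<Rightarrow> complex" where "shift m = Complex 0 (2 * pi * of_int m)"

text \<open>A third of the radius \<open>norm (A k) * \<rho> / 2\<close> of the disc known to lie in
  the image: the centre of a chosen lattice ball is at distance at most \<open>2 * h k\<close>, and
  its radius is at most \<open>h k\<close>.\<close>

definition h :: "int \<Rightarrow> real" where "h k = norm (A k) * \<rho> / 6"

text \<open>
  The pairs \<open>(j, m)\<close> for which the lattice point \<open>y j + 2 \<pi> i m\<close> lies in the right half of the
  square of side \<open>2 h k\<close> centred at \<open>F (y k)\<close>.
\<close>

definition J :: "int \<Rightarrow> (int \<times> int) set" where
  "J k = {\<lceil>Re (F (y k))\<rceil>..\<lfloor>Re (F (y k)) + h k\<rfloor>} \<times>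
     {\<lceil>(Im (F (y k)) - \<phi> - h k) / (2 * pi)\<rceil>..\<lfloor>(Im (F (y k)) - \<phi> + h k) / (2 * pi)\<rfloor>}"

text \<open>Points that can be followed for \<open>n\<close> steps through the balls about
  \<open>y k\<close>, each image being brought back by a period of the exponential. The recursion
  splits off the first step, so induction on \<open>n\<close> passes from \<open>k\<close> to the
  indices in \<open>J k\<close>.\<close>

fun X :: "nat \<Rightarrow> int \<Rightarrow> complex set" where
  "X 0 k = cball (y k) \<rho>"
| "X (Suc n) k = (\<Union>(j, m)\<in>J k. {t \<in> cball (y k) \<rho>. F t - shift m \<in> X n j})"

section \<open>Counting lattice balls in the image of a ball\<close>

lemma finite_J: "finite (J k)"
  by (simp add: J_def)

text \<open>The reason for taking only the right half of the square: indices never decrease, so the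
  hypotheses for indices from \<open>k0\<close> on stay available along an orbit.\<close>

lemma J_ge:
  assumes "k0 \<le> k" "(j, m) \<in> J k"
  shows "k0 \<le> j"
proof -
  have "of_int k \<le> Re (F (y k))" "Re (F (y k)) \<le> of_int j"
    using ReF[OF assms(1)] assms(2) by (auto simp: J_def y_def ceiling_le_iff)
  then show ?thesis
    using assms(1) by linarith
qed

lemma h_ge:
  assumes "k0 \<le> k"
  shows "8 \<le> h k"
proof -
  have "48 \<le> B * \<rho>"
    using B \<rho> by (simp add: field_simps)
  also have "\<dots> \<le> norm (A k) * \<rho>"
    using normA[OF assms] \<rho> by (intro mult_right_mono) auto
  finally show ?thesis
    by (simp add: h_def)
qed

lemma A_nonzero: "k0 \<le> k \<Longrightarrow> A k \<noteq> 0"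
  using h_ge[of k] by (auto simp: h_def)

text \<open>The box is \<open>h k\<close> wide and \<open>2 * h k\<close> high, with vertical
  spacing \<open>2 * pi\<close>. As \<open>h k \<ge> 8\<close>, the two counts are at least
  \<open>h k / 2\<close> and \<open>h k / 8\<close> even after rounding; 576 is 36 * 2 * 8.\<close>

lemma card_J_ge:
  assumes "k0 \<le> k"
  shows "(norm (A k) * \<rho>)\<^sup>2 / 576 \<le> real (card (J k))"
proof -
  have h: "8 \<le> h k"
    using h_ge[OF assms] .
  have 1: "h k / 2 \<le> real (card {\<lceil>Re (F (y k))\<rceil>..\<lfloor>Re (F (y k)) + h k\<rfloor>})"
    using card_int_interval_ge[of "Re (F (y k)) + h k" "Re (F (y k))"] h by linarith
  have "h k / 8 \<le> h k / 4 - 1"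
    using h by simp
  also have "\<dots> \<le> h k / pi - 1"
    using h pi_less_4 by (intro diff_right_mono divide_left_mono) auto
  also have "h k / pi = (Im (F (y k)) - \<phi> + h k) / (2 * pi) - (Im (F (y k)) - \<phi> - h k) / (2 * pi)"
    by (simp add: field_simps)
  also have "\<dots> - 1 \<le> real (card {\<lceil>(Im (F (y k)) - \<phi> - h k) / (2 * pi)\<rceil>..\<lfloor>(Im (F (y k)) - \<phi> + h k) / (2 * pi)\<rfloor>})"
    by (rule card_int_interval_ge)
  finally have 2: "h k / 8 \<le> real (card {\<lceil>(Im (F (y k)) - \<phi> - h k) / (2 * pi)\<rceil>..\<lfloor>(Im (F (y k)) - \<phi> + h k) / (2 * pi)\<rfloor>})" .
  have "(norm (A k) * \<rho>)\<^sup>2 / 576 = h k / 2 * (h k / 8)"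
    by (simp add: h_def power2_eq_square)
  also have "\<dots> \<le> real (card (J k))"
    using mult_mono[OF 1 2] h by (simp add: J_def card_cartesian_product)
  finally show ?thesis .
qed

lemma lattice_ball_subset:
  assumes k: "k0 \<le> k" and jm: "(j, m) \<in> J k"
  shows "cball (y j + shift m) \<rho> \<subseteq> cball (F (y k)) (norm (A k) * \<rho> / 2)"
proof
  fix w assume w: "w \<in> cball (y j + shift m) \<rho>"
  have "\<bar>Re (y j + shift m - F (y k))\<bar> \<le> h k"
    using jm h_ge[OF k] by (auto simp: J_def y_def shift_def ceiling_le_iff le_floor_iff)
  moreover have "\<bar>Im (y j + shift m - F (y k))\<bar> \<le> h k"
    using jm by (auto simp: J_def y_def shift_def ceiling_le_iff le_floor_iff abs_le_iff field_simps)
  ultimately have "norm (y j + shift m - F (y k)) \<le> 2 * h k"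
    using cmod_le[of "y j + shift m - F (y k)"] by linarith
  then have "dist (F (y k)) (y j + shift m) \<le> 2 * h k"
    by (simp add: dist_norm norm_minus_commute)
  moreover have "dist (y j + shift m) w \<le> h k"
    using w h_ge[OF k] \<rho> by simp
  ultimately have "dist (F (y k)) w \<le> 3 * h k"
    using dist_triangle[of "F (y k)" w "y j + shift m"] by linarith
  then show "w \<in> cball (F (y k)) (norm (A k) * \<rho> / 2)"
    by (simp add: h_def mult.commute)
qed

lemma surj:
  assumes k: "k0 \<le> k" and jm: "(j, m) \<in> J k" and w: "w \<in> cball (y j) \<rho>"
  shows "\<exists>t\<in>cball (y k) \<rho>. F t = w + shift m"
proof (rule near_linear_surj[of \<rho> "A k"])
  have "w + shift m \<in> cball (y j + shift m) \<rho>"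
    using w by (simp add: dist_norm algebra_simps)
  then show "w + shift m \<in> cball (F (y k)) (norm (A k) * \<rho> / 2)"
    using lattice_ball_subset[OF k jm] by blast
qed (use k \<rho> lin A_nonzero in \<open>auto simp: y_def\<close>)

section \<open>Compactness of the level sets\<close>

lemma X_subset: "X n k \<subseteq> cball (y k) \<rho>"
  by (cases n) auto

lemma X_Suc_subset: "X (Suc n) k \<subseteq> X n k"
proof (induction n arbitrary: k)
  case (Suc n)
  show ?case
  proof
    fix t assume "t \<in> X (Suc (Suc n)) k"
    then obtain j m where jm: "(j, m) \<in> J k" "t \<in> cball (y k) \<rho>" "F t - shift m \<in> X (Suc n) j"
      by (auto simp del: X.simps(2) simp: X.simps(2)[of "Suc n"])
    with Suc.IH[of j] show "t \<in> X (Suc n) k"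
      by (auto simp only: X.simps)
  qed
qed auto

lemma continuous_F:
  assumes "k0 \<le> k"
  shows "continuous_on (cball (y k) \<rho>) F"
proof -
  have "norm (F t - F u) \<le> (3/2 * norm (A k)) * norm (t - u)"
    if "t \<in> cball (y k) \<rho>" "u \<in> cball (y k) \<rho>" for t u
  proof -
    have "norm (F t - F u) \<le> norm (F t - F u - A k * (t - u)) + norm (A k * (t - u))"
      by (metis diff_add_cancel norm_triangle_ineq)
    then show ?thesis
      using lin[OF assms, of t u] that by (auto simp: y_def norm_mult)
  qed
  then show ?thesis
    by (intro lipschitz_on_continuous_on[of "3/2 * norm (A k)"] lipschitz_onI) (auto simp: dist_norm)
qed

lemma closed_X: "k0 \<le> k \<Longrightarrow> closed (X n k)"
proof (induction n arbitrary: k)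
  case (Suc n)
  have "closed {t \<in> cball (y k) \<rho>. F t - shift m \<in> X n j}" if "(j, m) \<in> J k" for j m
  proof -
    have "closed (X n j)"
      using Suc J_ge that by blast
    moreover have "continuous_on (cball (y k) \<rho>) (\<lambda>t. F t - shift m)"
      using continuous_F[OF Suc.prems] by (intro continuous_intros)
    ultimately have "closed (cball (y k) \<rho> \<inter> (\<lambda>t. F t - shift m) -` X n j)"
      using continuous_closed_preimage by blast
    then show ?thesis
      by (simp add: Int_def vimage_def)
  qed
  then show ?case
    using finite_J[of k] by (auto intro!: closed_UN)
qed auto

lemma compact_X: "k0 \<le> k \<Longrightarrow> compact (X n k)"
  using closed_X bounded_subset[OF bounded_cball X_subset] by (simp add: compact_eq_bounded_closed)

section \<open>Uniform content bound for the level sets\<close>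

text \<open>Two balls met by \<open>T\<close> have centres at distance at most
  \<open>e + 2 * \<rho> \<le> e + 1\<close>, while the lattice has spacing 1 and
  \<open>2 * pi\<close>. Finally \<open>2 * (e + 1) + 1 \<le> 5 * max 1 e\<close>.\<close>

lemma card_hits_le:
  fixes T :: "complex set"
  assumes T: "bounded T" "diameter T \<le> e" and S: "S \<subseteq> {(j, m). T \<inter> cball (y j + shift m) \<rho> \<noteq> {}}"
  shows "real (card S) \<le> 25 * (max 1 e)\<^sup>2"
proof -
  have e: "0 \<le> e"
    using T diameter_ge_0[OF T(1)] by linarith
  have "real (card S) \<le> (2 * (e + 1) + 1)\<^sup>2"
  proof (rule card_int_pairs_le)
    fix j m j' m' assume "(j, m) \<in> S" "(j', m') \<in> S"
    then obtain w w' where w: "w \<in> T" "w \<in> cball (y j + shift m) \<rho>" "w' \<in> T" "w' \<in> cball (y j' + shift m') \<rho>"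
      using S by blast
    have "dist w w' \<le> e"
      using w T diameter_bounded_bound[of T w w'] by linarith
    then have "dist (y j + shift m) (y j' + shift m') \<le> e + 2 * \<rho>"
      using w dist_triangle[of "y j + shift m" "y j' + shift m'" w] dist_triangle[of w "y j' + shift m'" w']
      by (simp add: dist_commute)
    then have n: "norm (y j + shift m - (y j' + shift m')) \<le> e + 1"
      using \<rho> by (simp add: dist_norm)
    have re: "\<bar>real_of_int (j - j')\<bar> \<le> e + 1"
      using abs_Re_le_cmod[of "y j + shift m - (y j' + shift m')"] n by (simp add: y_def shift_def)
    have "Im (y j + shift m - (y j' + shift m')) = 2 * pi * real_of_int (m - m')"
      by (simp add: y_def shift_def algebra_simps)
    then have "2 * pi * \<bar>real_of_int (m - m')\<bar> \<le> e + 1"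
      using abs_Im_le_cmod[of "y j + shift m - (y j' + shift m')"] n by (simp add: abs_mult)
    moreover have "1 * \<bar>real_of_int (m - m')\<bar> \<le> 2 * pi * \<bar>real_of_int (m - m')\<bar>"
      using pi_gt3 by (intro mult_right_mono) auto
    ultimately have "\<bar>real_of_int (m - m')\<bar> \<le> e + 1"
      by simp
    with re show "\<bar>real_of_int (j - j')\<bar> \<le> e + 1 \<and> \<bar>real_of_int (m - m')\<bar> \<le> e + 1" ..
  qed (use e in auto)
  also have "\<dots> \<le> (5 * max 1 e)\<^sup>2"
    using e by (intro power_mono) auto
  finally show ?thesis
    by (simp add: power_mult_distrib)
qed

text \<open>
  The large images of the covering sets meet so many of the lattice balls that they contribute
  enough by themselves; on the remaining balls the induction hypothesis applies, and the gain
  \<open>B powr (2 - s)\<close> pays for the distortion. The weights \<open>g\<close> treat both kinds of sets at once.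
\<close>

lemma X_cover_bound:
  fixes U :: "'i \<Rightarrow> complex set"
  assumes s: "0 < s" "s < 2" and Bs: "33000 / \<rho>\<^sup>2 \<le> B powr (2 - s)"
    and k: "k0 \<le> k" and I: "finite I" "\<And>i. i \<in> I \<Longrightarrow> bounded (U i)" and cov: "X n k \<subseteq> (\<Union>i\<in>I. U i)"
  shows "\<rho>\<^sup>2 / 33000 \<le> (\<Sum>i\<in>I. diameter (U i) powr s)"
  using k I cov
proof (induction n arbitrary: k I U)
  case 0
  have "\<rho>\<^sup>2 / 33000 \<le> \<rho>\<^sup>2"
    by simp
  also have "\<dots> \<le> (\<Sum>i\<in>I. diameter (U i) powr s)"
    using 0 \<rho> s by (intro sum_diameter_powr_ge_of_cball_cover[of _ _ _ _ "y k"]) auto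
  finally show ?case .
next
  case (Suc n)
  \<comment> \<open>33000 is slightly more than 576 * 57, the product of the losses in counting
    \<open>J k\<close> and in counting the balls that one image meets; so the same \<open>c\<close>
    comes out at the next level.\<close>
  define c where "c = \<rho>\<^sup>2 / 33000"
  have c: "0 < c" "c \<le> 1"
    using \<rho> power_le_one[of \<rho> 2] by (auto simp: c_def)
  show ?case
  proof (cases "\<exists>i\<in>I. diameter (U i) > 1")
    case True
    then obtain i where i: "i \<in> I" "diameter (U i) > 1"
      by blast
    have "1 \<le> diameter (U i) powr s"
      using i s by (intro ge_one_powr_ge_zero) auto
    also have "\<dots> \<le> (\<Sum>i\<in>I. diameter (U i) powr s)"
      using Suc.prems i by (intro member_le_sum) auto
    finally show ?thesis
      using c by (simp add: c_def)
  next
    case small: False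
    define a where "a = norm (A k)"
    have a: "B \<le> a" "a > 0"
      using normA A_nonzero Suc.prems by (auto simp: a_def)
    have B0: "B > 0"
      using B \<rho> by (smt (verit) divide_pos_pos)
    define d where "d i = diameter (U i)" for i
    have d: "0 \<le> d i" "d i \<le> 1" if "i \<in> I" for i
      using small Suc.prems that by (auto simp: d_def intro: diameter_ge_0)
    define e where "e i = 3/2 * a * d i" for i
    have e: "0 \<le> e i" if "i \<in> I" for i
      using d[OF that] a by (simp add: e_def)
    define T where "T i = F ` (U i \<inter> cball (y k) \<rho>)" for i
    have dT: "dist v w \<le> e i" if vw: "v \<in> T i" "w \<in> T i" and i: "i \<in> I" for v w i
    proof -
      obtain t u where tu: "t \<in> U i" "u \<in> U i" "t \<in> cball (y k) \<rho>" "u \<in> cball (y k) \<rho>" "v = F t" "w = F u"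
        using vw by (auto simp: T_def)
      have "norm (F t - F u) \<le> norm (F t - F u - A k * (t - u)) + norm (A k * (t - u))"
        by (metis diff_add_cancel norm_triangle_ineq)
      also have "\<dots> \<le> 3/2 * a * norm (t - u)"
        using lin[OF Suc.prems(1), of t u] tu by (auto simp: y_def norm_mult a_def)
      also have "\<dots> \<le> e i"
        unfolding e_def d_def using tu a i Suc.prems
        by (intro mult_left_mono) (auto simp flip: dist_norm intro!: diameter_bounded_bound)
      finally show ?thesis
        using tu by (simp add: dist_norm)
    qed
    have bT: "bounded (T i)" "diameter (T i) \<le> e i" if "i \<in> I" for i
      using dT[OF _ _ that] e[OF that] unfolding bounded_two_points
      by (blast, intro diameter_le) (auto simp: dist_norm)
    define H where "H i = {(j, m) \<in> J k. T i \<inter> cball (y j + shift m) \<rho> \<noteq> {}}" for i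
    have finH: "finite (H i)" for i
      using finite_J[of k] by (rule finite_subset[rotated]) (auto simp: H_def)
    \<comment> \<open>A large image is credited with \<open>c\<close>, all that a ball requires, at
      each ball that it meets; a small one with \<open>e i powr s\<close>.\<close>
    define g where "g i = (if e i > 1 then c else e i powr s)" for i
    have g0: "g i \<ge> 0" for i
      using c by (simp add: g_def)
    have local: "c \<le> (\<Sum>i\<in>I. if p \<in> H i then g i else 0)" if pJ: "p \<in> J k" for p
    proof -
      obtain j m where p: "p = (j, m)"
        by (cases p)
      define I' where "I' = {i \<in> I. p \<in> H i}"
      \<comment> \<open>Images are translated back by the period, so that they cover
        \<open>X n j\<close> and the induction hypothesis applies at \<open>j\<close>.\<close>
      define V where "V i = (\<lambda>w. w - shift m) ` (T i \<inter> cball (y j + shift m) \<rho>)" for i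
      have dV: "dist v w \<le> e i" if "v \<in> V i" "w \<in> V i" "i \<in> I" for v w i
        using that dT by (auto simp: V_def dist_norm)
      have "c \<le> (\<Sum>i\<in>I'. diameter (V i) powr s)"
        unfolding c_def
      proof (rule Suc.IH)
        show "k0 \<le> j"
          using J_ge Suc.prems(1) pJ p by blast
        show "bounded (V i)" if "i \<in> I'" for i
          using dV[of _ i] that unfolding bounded_two_points I'_def by blast
        show "X n j \<subseteq> (\<Union>i\<in>I'. V i)"
        proof
          fix x assume x: "x \<in> X n j"
          then have xj: "x \<in> cball (y j) \<rho>"
            using X_subset by blast
          then obtain t where t: "t \<in> cball (y k) \<rho>" "F t = x + shift m"
            using surj[of k j m x] Suc.prems(1) pJ p by blast
          then have "t \<in> X (Suc n) k"
            using pJ p x by (force intro: bexI[of _ "(j, m)"])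
          then obtain i where i: "i \<in> I" "t \<in> U i"
            using Suc.prems(4) by blast
          have "x + shift m \<in> T i \<inter> cball (y j + shift m) \<rho>"
            using t i xj by (auto simp: T_def dist_norm intro!: image_eqI[of _ _ t])
          then have "i \<in> I'" "x \<in> V i"
            using i pJ p by (auto simp: I'_def H_def V_def intro!: image_eqI[of _ _ "x + shift m"])
          then show "x \<in> (\<Union>i\<in>I'. V i)"
            by blast
        qed
      qed (use Suc.prems in \<open>auto simp: I'_def\<close>)
      also have "\<dots> \<le> (\<Sum>i\<in>I'. e i powr s)"
      proof (intro sum_mono powr_mono2)
        fix i assume "i \<in> I'"
        then have i: "i \<in> I"
          by (simp add: I'_def)
        show "diameter (V i) \<le> e i"
          using dV[of _ i] i e[OF i] by (intro diameter_le) (auto simp: dist_norm)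
        show "0 \<le> diameter (V i)"
          using dV[of _ i] i unfolding bounded_two_points by (intro diameter_ge_0) (auto simp: bounded_two_points)
      qed (use s in auto)
      finally have ce: "c \<le> (\<Sum>i\<in>I'. e i powr s)" .
      have "c \<le> (\<Sum>i\<in>I'. g i)"
      proof (cases "\<exists>i\<in>I'. e i > 1")
        case True
        then obtain i where i: "i \<in> I'" "e i > 1"
          by blast
        then have "c = g i"
          by (simp add: g_def)
        also have "\<dots> \<le> (\<Sum>i\<in>I'. g i)"
          using i Suc.prems g0 by (intro member_le_sum) (auto simp: I'_def)
        finally show ?thesis .
      next
        case False
        then have "(\<Sum>i\<in>I'. e i powr s) = (\<Sum>i\<in>I'. g i)"
          by (intro sum.cong) (auto simp: g_def)
        with ce show ?thesis
          by simp
      qed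
      also have "\<dots> = (\<Sum>i\<in>I. if p \<in> H i then g i else 0)"
        unfolding I'_def using Suc.prems by (intro sum.inter_filter) auto
      finally show ?thesis .
    qed
    \<comment> \<open>The constant 57 exceeds \<open>25 * (3/2)^2 = 225/4\<close>, from the hit
      count and the Lipschitz constant \<open>3/2 * a\<close> of \<open>F\<close>.\<close>
    have hits: "real (card (H i)) * g i \<le> c * (57 * a\<^sup>2) * d i powr s" if i: "i \<in> I" for i
    proof -
      have card: "real (card (H i)) \<le> 25 * (max 1 (e i))\<^sup>2"
        by (rule card_hits_le[OF bT[OF i]]) (auto simp: H_def)
      have ds: "(d i)\<^sup>2 \<le> d i powr s"
        using powr_mono'[of s 2 "d i"] d[OF i] s by simp
      show ?thesis
      proof (cases "e i > 1")
        case True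
        have "real (card (H i)) * g i \<le> 25 * (e i)\<^sup>2 * c"
          using True card c by (auto simp: g_def intro!: mult_right_mono)
        also have "\<dots> = c * (225/4 * a\<^sup>2) * (d i)\<^sup>2"
          by (simp add: e_def power_mult_distrib power_divide)
        also have "\<dots> \<le> c * (57 * a\<^sup>2) * d i powr s"
          using ds c by (intro mult_mono) auto
        finally show ?thesis .
      next
        case False
        have "real (card (H i)) * g i \<le> 25 * e i powr s"
          using False card c by (auto simp: g_def max_def intro!: mult_right_mono split: if_splits)
        also have "e i powr s = (3/2 * a) powr s * d i powr s"
          unfolding e_def by (rule powr_mult)
        also have "(3/2 * a) powr s = (3/2 * a)\<^sup>2 / (3/2 * a) powr (2 - s)"
          using a by (simp add: powr_diff)
        also have "(3/2 * a)\<^sup>2 / (3/2 * a) powr (2 - s) \<le> (3/2 * a)\<^sup>2 * c"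
        proof -
          \<comment> \<open>The gain from \<open>s < 2\<close>: since
            \<open>(3/2 * a) powr (2 - s)\<close> is at least \<open>1 / c\<close>, a small image
            costs no more than a multiple of \<open>c\<close>, like a large one.\<close>
          have "1 / c \<le> B powr (2 - s)"
            using Bs by (simp add: c_def)
          also have "\<dots> \<le> (3/2 * a) powr (2 - s)"
            using a B0 s by (intro powr_mono2) auto
          finally have "1 \<le> c * (3/2 * a) powr (2 - s)"
            using c by (simp add: field_simps)
          then have "(3/2 * a)\<^sup>2 * 1 \<le> (3/2 * a)\<^sup>2 * (c * (3/2 * a) powr (2 - s))"
            by (intro mult_left_mono) auto
          then show ?thesis
            using a by (simp add: field_simps)
        qed
        also have "25 * ((3/2 * a)\<^sup>2 * c * d i powr s) = c * (225/4 * a\<^sup>2) * d i powr s"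
          by (simp add: power_mult_distrib power_divide)
        also have "\<dots> \<le> c * (57 * a\<^sup>2) * d i powr s"
          using c by (intro mult_right_mono mult_left_mono) auto
        finally show ?thesis
          by (simp add: mult_right_mono)
      qed
    qed
    \<comment> \<open>Double counting of the pairs of a ball and a covering set whose image meets
      it.\<close>
    have "c * ((a * \<rho>)\<^sup>2 / 576) \<le> c * real (card (J k))"
      using card_J_ge[OF Suc.prems(1)] c by (intro mult_left_mono) (auto simp: a_def)
    also have "\<dots> = (\<Sum>p\<in>J k. c)"
      by simp
    also have "\<dots> \<le> (\<Sum>p\<in>J k. \<Sum>i\<in>I. if p \<in> H i then g i else 0)"
      by (intro sum_mono local)
    also have "\<dots> = (\<Sum>i\<in>I. \<Sum>p\<in>J k. if p \<in> H i then g i else 0)"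
      by (rule sum.swap)
    also have "\<dots> = (\<Sum>i\<in>I. real (card (H i)) * g i)"
    proof (intro sum.cong refl)
      fix i
      have "(\<Sum>p\<in>J k. if p \<in> H i then g i else 0) = (\<Sum>p\<in>{p \<in> J k. p \<in> H i}. g i)"
        using finite_J by (subst sum.inter_filter) auto
      also have "{p \<in> J k. p \<in> H i} = H i"
        by (auto simp: H_def)
      finally show "(\<Sum>p\<in>J k. if p \<in> H i then g i else 0) = real (card (H i)) * g i"
        by simp
    qed
    also have "\<dots> \<le> (\<Sum>i\<in>I. c * (57 * a\<^sup>2) * d i powr s)"
      by (intro sum_mono hits)
    also have "\<dots> = c * (57 * a\<^sup>2) * (\<Sum>i\<in>I. d i powr s)"
      by (simp add: sum_distrib_left)
    \<comment> \<open>The number of balls and the bound on the hits both scale like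
      \<open>c * a^2\<close>, which cancels; so neither \<open>k\<close> nor the level survives in
      the estimate.\<close>
    finally have "(c * a\<^sup>2) * (\<rho>\<^sup>2 / 576) \<le> (c * a\<^sup>2) * (57 * (\<Sum>i\<in>I. d i powr s))"
      by (simp add: power_mult_distrib mult_ac)
    then have "\<rho>\<^sup>2 / 576 \<le> 57 * (\<Sum>i\<in>I. d i powr s)"
      using c a by (subst (asm) mult_le_cancel_left_pos) auto
    moreover have "0 \<le> (\<Sum>i\<in>I. d i powr s)"
      by (intro sum_nonneg) auto
    ultimately show ?thesis
      by (simp add: d_def)
  qed
qed

section \<open>From the strip back to the plane\<close>

lemma orbit_in_strip:
  assumes f: "\<And>k t. k0 \<le> k \<Longrightarrow> t \<in> cball (y k) \<rho> \<Longrightarrow> f (exp t) = exp (F t)"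
    and k: "k0 \<le> k" and t: "t \<in> X n k" and i: "i \<le> n"
  shows "\<exists>j\<ge>k0. \<exists>u\<in>cball (y j) \<rho>. (f ^^ i) (exp t) = exp u"
  using k t i
proof (induction n arbitrary: k t i)
  case 0
  then show ?case
    by (intro exI[of _ k] conjI bexI[of _ t]) auto
next
  case (Suc n)
  show ?case
  proof (cases i)
    case 0
    have "t \<in> cball (y k) \<rho>"
      using Suc.prems(2) X_subset by blast
    with 0 Suc.prems(1) show ?thesis
      by (intro exI[of _ k] conjI bexI[of _ t]) auto
  next
    case (Suc i')
    obtain j m where jm: "(j, m) \<in> J k" "t \<in> cball (y k) \<rho>" "F t - shift m \<in> X n j"
      using Suc.prems by auto
    have "exp (shift m) = 1"
      by (simp add: exp_eq_1 shift_def)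
    then have "f (exp t) = exp (F t - shift m)"
      using f[OF Suc.prems(1) jm(2)] by (simp add: exp_diff)
    then have "(f ^^ i) (exp t) = (f ^^ i') (exp (F t - shift m))"
      by (simp add: Suc funpow_swap1)
    then show ?thesis
      using Suc.IH[OF J_ge[OF Suc.prems(1) jm(1)] jm(3), of i'] Suc.prems(3) Suc by auto
  qed
qed

lemma hausdorff_measure_neq_0:
  assumes s: "0 < s" "s < 2" and Bs: "33000 / \<rho>\<^sup>2 \<le> B powr (2 - s)"
    and f: "\<And>k t. k0 \<le> k \<Longrightarrow> t \<in> cball (y k) \<rho> \<Longrightarrow> f (exp t) = exp (F t)"
    and E: "\<And>z. (\<And>i. \<exists>j\<ge>k0. \<exists>u\<in>cball (y j) \<rho>. (f ^^ i) z = exp u) \<Longrightarrow> z \<in> E"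
  shows "hausdorff_measure s E \<noteq> 0"
proof (rule hausdorff_measure_neq_0_of_compact_approx)
  show "compact (X n k0)" "X (Suc n) k0 \<subseteq> X n k0" for n
    by (rule compact_X X_Suc_subset; simp)+
  show "\<rho>\<^sup>2 / 33000 \<le> (\<Sum>i\<in>I. diameter (U i) powr s)"
    if "finite I" "\<And>i. i \<in> I \<Longrightarrow> bounded (U i)" "X n k0 \<subseteq> (\<Union>i\<in>I. U i)" for n and I :: "nat set" and U
    by (rule X_cover_bound[OF s Bs _ that]) simp_all
  show "exp t \<in> E" if "t \<in> (\<Inter>n. X n k0)" for t
    using that by (intro E orbit_in_strip[OF f order_refl _ order_refl]) auto
  show "dist t u \<le> 2 * exp (- real_of_int k0) * dist (exp t) (exp u)"
    if "t \<in> (\<Inter>n. X n k0)" "u \<in> (\<Inter>n. X n k0)" for t u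
  proof -
    have "t \<in> X 0 k0" "u \<in> X 0 k0"
      using that by blast+
    then have tu: "t \<in> cball (y k0) \<rho>" "u \<in> cball (y k0) \<rho>"
      by simp_all
    \<comment> \<open>Subtracting the linear map \<open>exp (y k0) * t\<close> leaves a derivative
      of at most half of \<open>exp k0\<close> on the ball, as \<open>\<rho> \<le> 1/4\<close>.
      Hence the exponential expands distances there by at least half of
      \<open>exp k0\<close>.\<close>
    have "norm ((exp t - exp (y k0) * t) - (exp u - exp (y k0) * u)) \<le> exp (real_of_int k0) * (1/2) * norm (t - u)"
    proof (rule field_differentiable_bound[where S = "cball (y k0) \<rho>" and f' = "\<lambda>z. exp z - exp (y k0)"])
      fix z assume z: "z \<in> cball (y k0) \<rho>"
      show "((\<lambda>z. exp z - exp (y k0) * z) has_field_derivative exp z - exp (y k0)) (at z within cball (y k0) \<rho>)"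
        by (auto intro!: derivative_eq_intros)
      have "norm (z - y k0) \<le> 1/4"
        using z \<rho> by (simp add: dist_norm norm_minus_commute)
      then have "norm (exp (z - y k0) - 1) \<le> 1/2"
        using norm_exp_minus_1_le[of "z - y k0"] by simp
      then have "norm (exp (y k0)) * norm (exp (z - y k0) - 1) \<le> exp (real_of_int k0) * (1/2)"
        by (intro mult_mono) (auto simp: y_def)
      moreover have "exp z - exp (y k0) = exp (y k0) * (exp (z - y k0) - 1)"
        by (simp add: exp_diff field_simps)
      ultimately show "norm (exp z - exp (y k0)) \<le> exp (real_of_int k0) * (1/2)"
        by (simp add: norm_mult)
    qed (use tu in auto)
    moreover have "(exp t - exp (y k0) * t) - (exp u - exp (y k0) * u) = (exp t - exp u) - exp (y k0) * (t - u)"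
      by (simp add: algebra_simps)
    ultimately have "norm (exp (y k0) * (t - u)) - norm (exp t - exp u) \<le> exp (real_of_int k0) * (1/2) * norm (t - u)"
      by (metis norm_minus_commute norm_triangle_ineq2 order_trans)
    then have "exp (real_of_int k0) * norm (t - u) \<le> 2 * norm (exp t - exp u)"
      by (simp add: norm_mult y_def)
    then show ?thesis
      by (simp add: dist_norm exp_minus field_simps)
  qed
qed (use \<rho> s in auto)

end

section \<open>Genus zero products with zeros in a sector\<close>

lemma norm_Ln_1_plus_diff_le:
  assumes "Re v > -1/2" "Re w > -1/2"
  shows "norm (Ln (1 + v) - Ln (1 + w)) \<le> 2 * norm (v - w)"
proof (rule field_differentiable_bound[where S = "{z. Re z > -1/2}" and f' = "\<lambda>z. inverse (1 + z)"])
  show "convex {z. Re z > -1/2}"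
    using convex_halfspace_Re_gt by blast
  fix z :: complex assume z: "z \<in> {z. Re z > -1/2}"
  then show "((\<lambda>z. Ln (1 + z)) has_field_derivative inverse (1 + z)) (at z within {z. Re z > -1/2})"
    by (auto intro!: derivative_eq_intros simp: complex_nonpos_Reals_iff)
  have "1/2 \<le> norm (1 + z)"
    using z abs_Re_le_cmod[of "1 + z"] by simp
  then have "inverse (norm (1 + z)) \<le> inverse (1/2)"
    by (intro le_imp_inverse_le) auto
  then show "norm (inverse (1 + z)) \<le> 2"
    by (simp only: norm_inverse) simp
qed (use assms in auto)

lemma prodinf_norm_le_prodinf:
  fixes g :: "nat \<Rightarrow> 'a :: {real_normed_field, banach, second_countable_topology}" and h :: "nat \<Rightarrow> real"
  assumes "convergent_prod g" "convergent_prod h" "\<And>n. norm (g n) \<le> h n"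
  shows "norm (prodinf g) \<le> prodinf h"
proof (rule LIMSEQ_le)
  show "(\<lambda>n. norm (\<Prod>i\<le>n. g i)) \<longlonglongrightarrow> norm (prodinf g)" "(\<lambda>n. \<Prod>i\<le>n. h i) \<longlonglongrightarrow> prodinf h"
    by (intro tendsto_norm convergent_prod_LIMSEQ assms)+
  show "\<exists>N. \<forall>n\<ge>N. norm (\<Prod>i\<le>n. g i) \<le> (\<Prod>i\<le>n. h i)"
    using assms(3) by (auto simp flip: prod_norm intro!: prod_mono)
qed

lemma prodinf_le_norm_prodinf:
  fixes g :: "nat \<Rightarrow> 'a :: {real_normed_field, banach, second_countable_topology}" and h :: "nat \<Rightarrow> real"
  assumes "convergent_prod g" "convergent_prod h" "\<And>n. 0 \<le> h n" "\<And>n. h n \<le> norm (g n)"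
  shows "prodinf h \<le> norm (prodinf g)"
proof (rule LIMSEQ_le)
  show "(\<lambda>n. norm (\<Prod>i\<le>n. g i)) \<longlonglongrightarrow> norm (prodinf g)" "(\<lambda>n. \<Prod>i\<le>n. h i) \<longlonglongrightarrow> prodinf h"
    by (intro tendsto_norm convergent_prod_LIMSEQ assms)+
  show "\<exists>N. \<forall>n\<ge>N. (\<Prod>i\<le>n. h i) \<le> norm (\<Prod>i\<le>n. g i)"
    using assms(3,4) by (auto simp flip: prod_norm intro!: prod_mono)
qed

text \<open>The hypothesis on arguments enters as \<open>sector\<close>, a condition on the
  quotients \<open>exp t / b n\<close> for \<open>t\<close> in a strip of half-width \<rho>. The
  bound \<open>\<rho> \<le> \<delta> / 16\<close> keeps the variation of the derivative of the lift
  small against its size.\<close>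

locale genus_zero_sector =
  fixes f :: "complex \<Rightarrow> complex" and c :: complex and q :: nat and b :: "nat \<Rightarrow> complex"
    and \<phi> \<rho> \<delta> :: real and N :: nat
  assumes c: "c \<noteq> 0" and b: "\<And>n. b n \<noteq> 0" and summable_b: "summable (\<lambda>n. 1 / norm (b n))"
    and f_eq: "\<And>z. f z = c * z ^ q * (\<Prod>n. 1 + z / b n)"
    and holo: "f holomorphic_on UNIV"
    and \<delta>: "0 < \<delta>" "\<delta> \<le> 1" and \<rho>: "0 < \<rho>" "\<rho> \<le> \<delta> / 16"
    and sector: "\<And>n t. N \<le> n \<Longrightarrow> \<bar>Im t - \<phi>\<bar> \<le> \<rho> \<Longrightarrow> \<delta> * norm (exp t / b n) \<le> Re (exp t / b n)"
begin

section \<open>Growth of \<open>f\<close> and fast escape\<close>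

lemma conv_prod: "convergent_prod (\<lambda>n. 1 + z / b n)"
proof -
  have "summable (\<lambda>n. norm z * (1 / norm (b n)))"
    by (intro summable_mult summable_b)
  then have "summable (\<lambda>n. norm ((1 + z / b n) - 1))"
    by (simp add: norm_divide)
  then show ?thesis
    by (intro abs_convergent_prod_imp_convergent_prod summable_imp_abs_convergent_prod)
qed

lemma conv_prod_real: "convergent_prod (\<lambda>n. 1 + r / norm (b n))"
proof -
  have "summable (\<lambda>n. \<bar>r\<bar> * (1 / norm (b n)))"
    by (intro summable_mult summable_b)
  then have "summable (\<lambda>n. norm ((1 + r / norm (b n)) - 1))"
    by simp
  then show ?thesis
    by (intro abs_convergent_prod_imp_convergent_prod summable_imp_abs_convergent_prod)
qed

text \<open>The product with \<open>c\<close> and all \<open>b n\<close> replaced by their moduli: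
  an explicit majorant of \<open>max_modulus f\<close> and, far out in the sector, also a minorant
  of the modulus of \<open>f\<close> once the radius is divided by \<open>K\<close>.\<close>

definition P :: "real \<Rightarrow> real" where
  "P r = norm c * r ^ q * (\<Prod>n. 1 + r / norm (b n))"

lemma prodinf_ge_1:
  assumes "r \<ge> 0"
  shows "1 \<le> (\<Prod>n. 1 + r / norm (b n))"
  using prod_le_prodinf[OF convergent_prod_has_prod[OF conv_prod_real], of r 0] assms by simp

lemma norm_f_le: "norm (f z) \<le> P (norm z)"
proof -
  have "norm (\<Prod>n. 1 + z / b n) \<le> (\<Prod>n. 1 + norm z / norm (b n))"
  proof (rule prodinf_norm_le_prodinf[OF conv_prod conv_prod_real])
    show "norm (1 + z / b n) \<le> 1 + norm z / norm (b n)" for n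
      using norm_triangle_ineq[of 1 "z / b n"] by (simp add: norm_divide)
  qed
  then show ?thesis
    by (auto simp: f_eq P_def norm_mult norm_power intro!: mult_left_mono)
qed

lemma max_modulus_le_P: "0 \<le> r \<Longrightarrow> max_modulus f r \<le> P r"
  using norm_f_le by (intro max_modulus_le) auto

lemma P_mono:
  assumes "0 \<le> r" "r \<le> s"
  shows "P r \<le> P s"
proof -
  have "(\<Prod>n. 1 + r / norm (b n)) \<le> (\<Prod>n. 1 + s / norm (b n))"
    using assms
    by (intro prodinf_le[OF convergent_prod_has_prod[OF conv_prod_real] convergent_prod_has_prod[OF conv_prod_real]])
       (auto intro!: divide_right_mono)
  then show ?thesis
    unfolding P_def using assms prodinf_ge_1[of r]
    by (intro mult_mono power_mono mult_nonneg_nonneg) auto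
qed

text \<open>\<open>1 / K \<le> \<delta>\<close> serves the factors with \<open>n \<ge> N\<close>.
  \<open>K \<ge> 3\<close> serves the others once \<open>norm w \<ge> 4\<close>, and gives
  \<open>2 * (1 + x) \<le> 1 + K * x\<close> for \<open>x \<ge> 1\<close>.\<close>

definition K :: real where "K = 3 / \<delta>"

lemma K: "3 \<le> K" "1 / K \<le> \<delta>"
  using \<delta> by (auto simp: K_def field_simps)

lemma eventually_large: "eventually (\<lambda>r. \<forall>n<m. norm (b n) \<le> r) at_top"
  by (induction m) (simp_all add: All_less_Suc eventually_conj_iff eventually_ge_at_top)

text \<open>
  Moving outwards by the factor \<open>K\<close> in the sector makes up for the difference between
  \<open>norm (1 + w)\<close> and \<open>1 + norm w\<close> in each factor.
\<close>

lemma P_le_norm_f: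
  assumes t: "\<bar>Im t - \<phi>\<bar> \<le> \<rho>" and large: "\<forall>n<N. 4 * norm (b n) \<le> exp (Re t)"
  shows "P (exp (Re t) / K) \<le> norm (f (exp t))"
proof -
  have K0: "K > 0"
    using K by linarith
  have "(\<Prod>n. 1 + exp (Re t) / K / norm (b n)) \<le> norm (\<Prod>n. 1 + exp t / b n)"
  proof (rule prodinf_le_norm_prodinf[OF conv_prod conv_prod_real])
    fix n
    define w where "w = exp t / b n"
    have w: "norm w = exp (Re t) / norm (b n)"
      by (simp add: w_def norm_divide)
    have "1 + norm w / K \<le> norm (1 + w)"
    proof (cases "n < N")
      case True
      then have "4 \<le> norm w"
        using large b[of n] by (simp add: w field_simps)
      moreover have "norm w / K \<le> norm w / 3"
        using K by (intro divide_left_mono) auto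
      moreover have "norm w - 1 \<le> norm (1 + w)"
        using norm_triangle_ineq2[of w "-1"] by (simp add: add.commute)
      ultimately show ?thesis
        by linarith
    next
      case False
      have "norm w / K \<le> \<delta> * norm w"
        using mult_right_mono[OF K(2), of "norm w"] by simp
      also have "\<dots> \<le> Re w"
        unfolding w_def using False t by (intro sector) auto
      finally show ?thesis
        using complex_Re_le_cmod[of "1 + w"] by simp
    qed
    then show "1 + exp (Re t) / K / norm (b n) \<le> norm (1 + exp t / b n)"
      unfolding w by (simp add: w_def mult.commute)
  qed (use K0 in auto)
  moreover have "(exp (Re t) / K) ^ q \<le> exp (Re t) ^ q"
    using K K0 by (intro power_mono) (auto simp: field_simps)
  ultimately show ?thesis
    unfolding P_def f_eq norm_mult norm_power norm_exp_eq_Re using prodinf_ge_1[of "exp (Re t) / K"] K0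
    by (intro mult_mono) auto
qed

text \<open>Every factor with \<open>norm (b n) \<le> r\<close> at least doubles when
  \<open>r\<close> is replaced by \<open>K * r\<close>. As \<open>m\<close> is arbitrary, this is
  superpolynomial growth.\<close>

lemma P_K_mult:
  assumes r: "0 \<le> r" and large: "\<forall>n<m. norm (b n) \<le> r"
  shows "2 ^ m * P r \<le> P (K * r)"
proof -
  have K0: "K > 0" "K \<ge> 1"
    using K by linarith+
  \<comment> \<open>The factor \<open>2 ^ m\<close> is spread over the first \<open>m\<close>
    factors, to allow a comparison term by term.\<close>
  define g where "g n = (if n \<in> {..<m} then 2 else 1 :: real)" for n :: nat
  have g: "g has_prod (\<Prod>n<m. 2)"
    unfolding g_def by (rule has_prod_If_finite_set) simp
  have h: "(\<lambda>n. 1 + r / norm (b n)) has_prod (\<Prod>n. 1 + r / norm (b n))" for r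
    by (rule convergent_prod_has_prod[OF conv_prod_real])
  have gh: "(\<lambda>n. g n * (1 + r / norm (b n))) has_prod ((\<Prod>n<m. 2) * (\<Prod>n. 1 + r / norm (b n)))"
    by (rule has_prod_mult[OF g h])
  have "prodinf (\<lambda>n. g n * (1 + r / norm (b n))) \<le> prodinf (\<lambda>n. 1 + K * r / norm (b n))"
  proof (rule prodinf_le[OF gh h])
    fix n
    have "2 * (1 + r / norm (b n)) \<le> 1 + K * r / norm (b n)" if "n < m"
    proof -
      have "1 \<le> r / norm (b n)"
        using large that b[of n] by (simp add: field_simps)
      moreover have "3 * (r / norm (b n)) \<le> K * (r / norm (b n))"
        using K r by (intro mult_right_mono) auto
      ultimately show ?thesis
        by simp
    qed
    moreover have "1 + r / norm (b n) \<le> 1 + K * r / norm (b n)"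
      using K0 r by (auto intro!: divide_right_mono simp: mult_le_cancel_right1)
    ultimately show "0 \<le> g n * (1 + r / norm (b n)) \<and> g n * (1 + r / norm (b n)) \<le> 1 + K * r / norm (b n)"
      using r by (auto simp: g_def)
  qed
  then have "2 ^ m * (\<Prod>n. 1 + r / norm (b n)) \<le> (\<Prod>n. 1 + K * r / norm (b n))"
    using has_prod_unique[OF gh] by simp
  moreover have "r ^ q \<le> (K * r) ^ q"
    using K0 r by (intro power_mono) (auto simp: mult_le_cancel_right1)
  ultimately have "norm c * r ^ q * (2 ^ m * (\<Prod>n. 1 + r / norm (b n))) \<le> P (K * r)"
    unfolding P_def using prodinf_ge_1[of r] r K0 by (intro mult_mono) auto
  then show ?thesis
    by (simp add: P_def mult_ac)
qed

text \<open>Two factors of the product already grow quadratically; \<open>C\<close> collects the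
  constants of that bound.\<close>

lemma eventually_P_gt: "eventually (\<lambda>r. r < P (r / K)) at_top"
proof -
  have K0: "K > 0"
    using K by linarith
  define C where "C = K\<^sup>2 * (norm (b 0) * norm (b 1)) / norm c"
  have "r < P (r / K)" if r: "r > C" "r \<ge> K" for r
  proof -
    have r1: "1 \<le> r / K"
      using r K0 by simp
    have "r / K / norm (b 0) * (r / K / norm (b 1)) \<le> (1 + r / K / norm (b 0)) * (1 + r / K / norm (b 1))"
      using r1 K0 r by (intro mult_mono) auto
    also have "\<dots> = (\<Prod>n<2. 1 + r / K / norm (b n))"
      by (simp add: numeral_2_eq_2)
    also have "\<dots> \<le> (\<Prod>n. 1 + r / K / norm (b n))"
      using r1 r K0 by (intro prod_le_prodinf[OF convergent_prod_has_prod[OF conv_prod_real]]) auto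
    finally have 1: "r / K / norm (b 0) * (r / K / norm (b 1)) \<le> (\<Prod>n. 1 + r / K / norm (b n))" .
    have "r * 1 < r * (r / C)"
      using r K0 c b by (intro mult_strict_left_mono) (auto simp: C_def field_simps)
    also have "r * (r / C) = norm c * 1 * (r / K / norm (b 0) * (r / K / norm (b 1)))"
      by (simp add: C_def field_simps power2_eq_square)
    also have "\<dots> \<le> P (r / K)"
      unfolding P_def using 1 r1 r K0 by (intro mult_mono) (auto intro: one_le_power)
    finally show ?thesis
      by simp
  qed
  then show ?thesis
    by (intro eventually_mono[OF eventually_conj[OF eventually_gt_at_top[of C] eventually_ge_at_top[of K]]]) auto
qed

lemma exists_escape_radius:
  "\<exists>R0>0. \<forall>z. (\<forall>i. \<exists>t. (f ^^ i) z = exp t \<and> \<bar>Im t - \<phi>\<bar> \<le> \<rho> \<and> R0 \<le> exp (Re t)) \<longrightarrow> z \<in> fast_escaping_set f"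
proof -
  have K0: "K > 0"
    using K by linarith
  obtain m where m: "K\<^sup>2 \<le> 2 ^ m"
    using real_arch_pow[of 2 "K\<^sup>2"] by (auto intro: less_imp_le)
  have "eventually (\<lambda>R. \<forall>r\<ge>R. 0 < r \<and> (\<forall>n<m. norm (b n) \<le> r) \<and> (\<forall>n<N. norm (b n) \<le> r / 4) \<and> r < P (r / K)) at_top"
    by (rule eventually_all_ge_at_top)
      (intro eventually_conj eventually_gt_at_top eventually_large eventually_P_gt
        eventually_compose_filterlim[OF eventually_large] filterlim_at_top_div_const_nat
        filterlim_tendsto_pos_mult_at_top filterlim_ident; real_asymp)
  then obtain R where "\<forall>r\<ge>R. 0 < r \<and> (\<forall>n<m. norm (b n) \<le> r) \<and> (\<forall>n<N. norm (b n) \<le> r / 4) \<and> r < P (r / K)"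
    by (auto simp: eventually_at_top_linorder)
  then have R: "\<And>r. r \<ge> R \<Longrightarrow> 0 < r" "\<And>r. r \<ge> R \<Longrightarrow> \<forall>n<m. norm (b n) \<le> r"
      "\<And>r. r \<ge> R \<Longrightarrow> \<forall>n<N. 4 * norm (b n) \<le> r" "\<And>r. r \<ge> R \<Longrightarrow> r < P (r / K)"
    by (auto simp: field_simps)
  have adm: "admissible_radius f R"
    unfolding admissible_radius_def
  proof (intro conjI allI impI)
    fix r assume r: "r \<ge> R"
    define t where "t = Complex (ln r) \<phi>"
    have t: "exp (Re t) = r"
      using R(1)[OF r] by (simp add: t_def)
    have "r < P (r / K)"
      by (rule R(4)[OF r])
    also have "\<dots> \<le> norm (f (exp t))"
      using P_le_norm_f[of t] R(3)[OF r] t \<rho> by (simp add: t_def)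
    also have "\<dots> \<le> max_modulus f r"
      using t by (intro norm_le_max_modulus holo) simp
    finally show "r < max_modulus f r" .
  qed (use R(1) in auto)
  show ?thesis
  proof (intro exI[of _ "K\<^sup>2 * R"] conjI allI impI)
    show "0 < K\<^sup>2 * R"
      using K0 R(1)[of R] by simp
    fix z assume z: "\<forall>i. \<exists>t. (f ^^ i) z = exp t \<and> \<bar>Im t - \<phi>\<bar> \<le> \<rho> \<and> K\<^sup>2 * R \<le> exp (Re t)"
    have K2: "1 \<le> K\<^sup>2"
      using K by (intro one_le_power) auto
    \<comment> \<open>The lead \<open>K^2\<close> over the iterated maximum modulus is preserved:
      one \<open>K\<close> is lost in comparing \<open>norm (f (exp t))\<close> with
      \<open>P\<close>, and the other gains \<open>2 ^ m \<ge> K^2\<close>, which restores the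
      lead.\<close>
    have *: "K\<^sup>2 * (max_modulus f ^^ n) R \<le> norm ((f ^^ n) z)" for n
    proof (induction n)
      case 0
      then show ?case
        using z[rule_format, of 0] by (auto simp: norm_exp_eq_Re)
    next
      case (Suc n)
      define p where "p = (max_modulus f ^^ n) R"
      have p: "R \<le> p"
        unfolding p_def by (rule max_modulus_iterate_ge[OF adm])
      obtain t where t: "(f ^^ n) z = exp t" "\<bar>Im t - \<phi>\<bar> \<le> \<rho>" "K\<^sup>2 * R \<le> exp (Re t)"
        using z by blast
      have "R \<le> exp (Re t)"
        using t(3) K2 R(1)[of R] by (smt (verit) mult_le_cancel_right1)
      have "K\<^sup>2 * max_modulus f p \<le> 2 ^ m * P p"
        using m max_modulus_le_P[of p] R(1)[OF p] K0
          order_trans[OF norm_ge_zero norm_le_max_modulus[OF holo, of "of_real p" p]]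
        by (intro mult_mono) auto
      also have "\<dots> \<le> P (K * p)"
        using R(1,2)[OF p] by (intro P_K_mult) auto
      also have "\<dots> \<le> P (exp (Re t) / K)"
        using Suc.IH t(1) K0 R(1)[OF p] by (intro P_mono) (auto simp: p_def field_simps power2_eq_square)
      also have "\<dots> \<le> norm (f (exp t))"
        using t R(3)[OF \<open>R \<le> exp (Re t)\<close>] by (intro P_le_norm_f) auto
      finally show ?case
        using t(1) by (simp add: p_def)
    qed
    have "(max_modulus f ^^ n) R \<le> norm ((f ^^ (n + 0)) z)" for n
      using *[of n] K2 max_modulus_iterate_ge[OF adm, of n] R(1)[of R]
      by (smt (verit) add.right_neutral mult_le_cancel_right1)
    then have "z \<in> fast_escaping_wrt R f"
      unfolding fast_escaping_wrt_def by blast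
    then show "z \<in> fast_escaping_set f"
      using adm by (auto simp: fast_escaping_set_def)
  qed
qed

section \<open>The logarithmic lift of \<open>f\<close>\<close>

definition y :: "int \<Rightarrow> complex" where "y k = Complex (of_int k) \<phi>"

definition w :: "nat \<Rightarrow> complex \<Rightarrow> complex" where "w n t = exp t / b n"

text \<open>
  For the finitely many \<open>n < N\<close> the logarithm of \<open>1 + exp t / b n\<close> is expanded at infinity, so that
  no branch cut of \<^const>\<open>Ln\<close> is met far to the right.
\<close>

definition Lg :: "nat \<Rightarrow> complex \<Rightarrow> complex" where
  "Lg n t = (if n < N then t - Ln (b n) + Ln (1 + b n * exp (- t)) else Ln (1 + w n t))"

text \<open>A common measure for the terms of the derivative: \<open>4 * \<rho> * D n k\<close>
  bounds the variation of a term over the ball, \<open>\<delta> * D n k\<close> its real part from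
  below. For \<open>n < N\<close>, 1 is the limit of \<open>x / (1 + x)\<close> far to the
  right.\<close>

definition D :: "nat \<Rightarrow> int \<Rightarrow> real" where
  "D n k = (if n < N then 1 else norm (w n (y k)) / (1 + norm (w n (y k))))"

definition dLg :: "nat \<Rightarrow> int \<Rightarrow> complex" where
  "dLg n k = (if n < N then 1 else w n (y k) / (1 + w n (y k)))"

definition F :: "complex \<Rightarrow> complex" where
  "F t = Ln c + of_nat q * t + (\<Sum>n. Lg n t)"

text \<open>For \<open>n < N\<close> the summand is the limit 1 and not the exact derivative at
  \<open>y k\<close>; the near-linearity estimate absorbs the difference.\<close>

definition A :: "int \<Rightarrow> complex" where
  "A k = of_nat q + (\<Sum>n. dLg n k)"

text \<open>Far enough to the right for the expansion at infinity; the \<open>- 1\<close> allows for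
  the points of the ball about \<open>y k\<close> with real part below \<open>k\<close>.\<close>

definition large :: "int \<Rightarrow> bool" where
  "large k \<longleftrightarrow> (\<forall>n<N. norm (b n) \<le> \<rho> * exp (of_int k - 1))"

lemma \<rho>_le: "\<rho> \<le> 1/16"
  using \<rho> \<delta> by linarith

lemma norm_w: "norm (w n t) = exp (Re t) / norm (b n)"
  by (simp add: w_def norm_divide)

lemma Re_w_ge:
  assumes "N \<le> n" "\<bar>Im t - \<phi>\<bar> \<le> \<rho>"
  shows "\<delta> * norm (w n t) \<le> Re (w n t)" "0 \<le> Re (w n t)" "1 + w n t \<noteq> 0" "1 \<le> norm (1 + w n t)"
proof -
  show 1: "\<delta> * norm (w n t) \<le> Re (w n t)"
    unfolding w_def by (rule sector[OF assms])
  then show 2: "0 \<le> Re (w n t)"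
    using \<delta> by (smt (verit) mult_nonneg_nonneg norm_ge_zero)
  then show 3: "1 \<le> norm (1 + w n t)"
    using complex_Re_le_cmod[of "1 + w n t"] by simp
  then show "1 + w n t \<noteq> 0"
    by auto
qed

lemma cball_y:
  assumes "t \<in> cball (y k) \<rho>"
  shows "\<bar>Im t - \<phi>\<bar> \<le> \<rho>" "of_int k - 1 \<le> Re t" "norm (t - y k) \<le> \<rho>"
proof -
  show 1: "norm (t - y k) \<le> \<rho>"
    using assms by (simp add: dist_norm norm_minus_commute)
  show "\<bar>Im t - \<phi>\<bar> \<le> \<rho>"
    using 1 abs_Im_le_cmod[of "t - y k"] by (simp add: y_def)
  show "of_int k - 1 \<le> Re t"
    using 1 abs_Re_le_cmod[of "t - y k"] \<rho>_le by (simp add: y_def)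
qed

lemma y_in_cball: "y k \<in> cball (y k) \<rho>"
  using \<rho> by simp

lemma small_of_large:
  assumes k: "large k" and n: "n < N" and t: "t \<in> cball (y k) \<rho>"
  shows "norm (b n * exp (- t)) \<le> \<rho>"
proof -
  have "norm (b n) \<le> \<rho> * exp (of_int k - 1)"
    using k n by (simp add: large_def)
  also have "\<dots> \<le> \<rho> * exp (Re t)"
    using cball_y(2)[OF t] \<rho> by (intro mult_left_mono) auto
  finally show ?thesis
    by (simp add: norm_mult norm_divide exp_minus field_simps)
qed

lemma exp_Lg:
  assumes k: "large k" and t: "t \<in> cball (y k) \<rho>"
  shows "exp (Lg n t) = 1 + exp t / b n"
proof (cases "n < N")
  case True
  have "1 + b n * exp (- t) \<noteq> 0"
  proof
    assume "1 + b n * exp (- t) = 0"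
    then have "b n * exp (- t) = - 1"
      by (simp add: add_eq_0_iff)
    with small_of_large[OF k True t] \<rho>_le show False
      by simp
  qed
  then show ?thesis
    using True b[of n] by (simp add: Lg_def exp_add exp_diff exp_minus field_simps)
next
  case False
  then show ?thesis
    using Re_w_ge(3)[of n t] cball_y[OF t] by (simp add: Lg_def w_def)
qed

text \<open>The derivative of \<open>Lg n t - t\<close> is \<open>- v / (1 + v)\<close>, where
  \<open>v = b n * exp (- t)\<close> has modulus at most \<rho>.\<close>

lemma near_linear_Lg_small:
  assumes k: "large k" and n: "n < N" and t: "t \<in> cball (y k) \<rho>" and u: "u \<in> cball (y k) \<rho>"
  shows "norm ((Lg n t - t) - (Lg n u - u)) \<le> 4 * \<rho> * norm (t - u)"
proof (rule field_differentiable_bound[where S = "cball (y k) \<rho>"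
    and f' = "\<lambda>z. - (b n * exp (- z)) / (1 + b n * exp (- z))"])
  fix z assume z: "z \<in> cball (y k) \<rho>"
  define v where "v = b n * exp (- z)"
  have v: "norm v \<le> \<rho>"
    unfolding v_def by (rule small_of_large[OF k n z])
  have Re: "Re (1 + v) \<ge> 1/2"
    using v \<rho>_le abs_Re_le_cmod[of v] by simp
  then have "1 + v \<notin> \<real>\<^sub>\<le>\<^sub>0"
    by (simp add: complex_nonpos_Reals_iff)
  then have "1 + b n * exp (- z) \<notin> \<real>\<^sub>\<le>\<^sub>0"
    by (simp add: v_def)
  then have "((\<lambda>z. - Ln (b n) + Ln (1 + b n * exp (- z))) has_field_derivative
      - (b n * exp (- z)) / (1 + b n * exp (- z))) (at z within cball (y k) \<rho>)"
    by (auto intro!: derivative_eq_intros simp: field_simps)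
  then show "((\<lambda>t. Lg n t - t) has_field_derivative
      - (b n * exp (- z)) / (1 + b n * exp (- z))) (at z within cball (y k) \<rho>)"
    using n by (simp add: Lg_def)
  have "1/2 \<le> norm (1 + v)"
    using Re complex_Re_le_cmod[of "1 + v"] by linarith
  then have "norm v / norm (1 + v) \<le> \<rho> / (1/2)"
    using v \<rho> by (intro frac_le) auto
  then show "norm (- (b n * exp (- z)) / (1 + b n * exp (- z))) \<le> 4 * \<rho>"
    using \<rho> unfolding v_def[symmetric] norm_divide norm_minus_cancel by simp
qed (use t u in auto)

text \<open>With \<open>v = w n (y k)\<close> the derivatives at \<open>z\<close> and
  \<open>y k\<close> differ by \<open>(w n z - v) / ((1 + w n z) * (1 + v))\<close>. The numerator
  is at most \<open>2 * \<rho> * norm v\<close>, and in the right half-plane the denominator is at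
  least \<open>(1 + norm v) / 2\<close>; so the variation is small relative to
  \<open>D n k\<close>.\<close>

lemma near_linear_Lg_sector:
  assumes n: "N \<le> n" and t: "t \<in> cball (y k) \<rho>" and u: "u \<in> cball (y k) \<rho>"
  shows "norm ((Lg n t - dLg n k * t) - (Lg n u - dLg n k * u)) \<le> 4 * \<rho> * D n k * norm (t - u)"
proof (rule field_differentiable_bound[where S = "cball (y k) \<rho>"
    and f' = "\<lambda>z. w n z / (1 + w n z) - w n (y k) / (1 + w n (y k))"])
  fix z assume z: "z \<in> cball (y k) \<rho>"
  note wz = Re_w_ge[OF n cball_y(1)[OF z]] and wy = Re_w_ge[OF n cball_y(1)[OF y_in_cball[of k]]]
  have "1 + exp z / b n \<notin> \<real>\<^sub>\<le>\<^sub>0"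
    using wz(2) by (simp add: complex_nonpos_Reals_iff w_def)
  then have "((\<lambda>z. Ln (1 + exp z / b n) - d * z) has_field_derivative
      inverse (1 + exp z / b n) * (exp z / b n) - d) (at z within cball (y k) \<rho>)" for d
    using b[of n] by (auto intro!: derivative_eq_intros)
  from this[of "w n (y k) / (1 + w n (y k))"] have
    "((\<lambda>z. Ln (1 + exp z / b n) - w n (y k) / (1 + w n (y k)) * z) has_field_derivative
      w n z / (1 + w n z) - w n (y k) / (1 + w n (y k))) (at z within cball (y k) \<rho>)"
    unfolding w_def[of n z] by (simp add: inverse_eq_divide mult.commute)
  then show "((\<lambda>t. Lg n t - dLg n k * t) has_field_derivative
      w n z / (1 + w n z) - w n (y k) / (1 + w n (y k))) (at z within cball (y k) \<rho>)"
    using n by (simp add: Lg_def dLg_def w_def)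
  have "w n z / (1 + w n z) - w n (y k) / (1 + w n (y k)) = (w n z - w n (y k)) / ((1 + w n z) * (1 + w n (y k)))"
    using wz(3) wy(3) by (simp add: field_simps)
  also have "w n z - w n (y k) = w n (y k) * (exp (z - y k) - 1)"
    using exp_add[of "y k" "z - y k"] by (simp add: w_def right_diff_distrib)
  finally have "norm (w n z / (1 + w n z) - w n (y k) / (1 + w n (y k))) =
      norm (w n (y k)) * norm (exp (z - y k) - 1) / (norm (1 + w n z) * norm (1 + w n (y k)))"
    by (simp add: norm_mult norm_divide)
  also have "\<dots> \<le> norm (w n (y k)) * (2 * \<rho>) / (1 * ((1 + norm (w n (y k))) / 2))"
  proof (intro frac_le mult_mono)
    show "norm (exp (z - y k) - 1) \<le> 2 * \<rho>"
      using norm_exp_minus_1_le[of "z - y k"] cball_y(3)[OF z] \<rho>_le by simp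
    have *: "norm (w n (y k)) \<le> norm (1 + w n (y k))"
      using wy(2) by (simp add: cmod_def power2_eq_square algebra_simps)
    show "(1 + norm (w n (y k))) / 2 \<le> norm (1 + w n (y k))"
      using add_mono[OF wy(4) *] by simp
  qed (use wz \<rho> in \<open>auto intro!: add_pos_nonneg\<close>)
  also have "\<dots> = 4 * \<rho> * D n k"
    using n by (simp add: D_def)
  finally show "norm (w n z / (1 + w n z) - w n (y k) / (1 + w n (y k))) \<le> 4 * \<rho> * D n k" .
qed (use t u in auto)

lemma near_linear_Lg:
  assumes "large k" "t \<in> cball (y k) \<rho>" "u \<in> cball (y k) \<rho>"
  shows "norm (Lg n t - Lg n u - dLg n k * (t - u)) \<le> 4 * \<rho> * D n k * norm (t - u)"
proof (cases "n < N")
  case True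
  then have "norm (Lg n t - Lg n u - dLg n k * (t - u)) = norm ((Lg n t - t) - (Lg n u - u))"
    by (simp add: dLg_def algebra_simps)
  then show ?thesis
    using near_linear_Lg_small[OF assms(1) True assms(2,3)] True by (simp add: D_def)
next
  case False
  have eq: "Lg n t - Lg n u - dLg n k * (t - u) = (Lg n t - dLg n k * t) - (Lg n u - dLg n k * u)"
    by (simp add: algebra_simps)
  show ?thesis
    unfolding eq using assms False by (intro near_linear_Lg_sector) auto
qed

lemma D_nonneg: "0 \<le> D n k"
  by (simp add: D_def)

text \<open>This excludes cancellation: \<open>Re (v / (1 + v))\<close> is
  \<open>(Re v + norm v ^ 2) / norm (1 + v) ^ 2\<close>, with numerator at least
  \<open>\<delta> * norm v * (1 + norm v)\<close> and denominator at most
  \<open>(1 + norm v) ^ 2\<close>.\<close>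

lemma Re_dLg_ge: "\<delta> * D n k \<le> Re (dLg n k)"
proof (cases "n < N")
  case False
  define v where "v = w n (y k)"
  have v: "\<delta> * norm v \<le> Re v" "1 \<le> norm (1 + v)"
    using Re_w_ge[of n "y k"] False cball_y[OF y_in_cball, of k] by (auto simp: v_def)
  have "Re (v / (1 + v)) = Re (v * cnj (1 + v)) / (norm (1 + v))\<^sup>2"
    by (simp add: complex_div_cnj[of v "1 + v"] flip: of_real_power)
  also have "v * cnj (1 + v) = v + v * cnj v"
    by (simp add: algebra_simps)
  also have "v * cnj v = of_real ((norm v)\<^sup>2)"
    by (rule complex_norm_square[symmetric])
  finally have eq: "Re (v / (1 + v)) = (Re v + (norm v)\<^sup>2) / (norm (1 + v))\<^sup>2"
    by simp
  have "\<delta> * (norm v / (1 + norm v)) = \<delta> * (norm v * (1 + norm v)) / (1 + norm v)\<^sup>2"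
    by (simp add: power2_eq_square add_nonneg_eq_0_iff)
  also have "\<dots> \<le> (Re v + (norm v)\<^sup>2) / (norm (1 + v))\<^sup>2"
  proof (rule frac_le)
    have "\<delta> * (norm v)\<^sup>2 \<le> 1 * (norm v)\<^sup>2"
      using \<delta> by (intro mult_right_mono) auto
    then show "\<delta> * (norm v * (1 + norm v)) \<le> Re v + (norm v)\<^sup>2"
      using v(1) by (simp add: algebra_simps power2_eq_square)
    show "(norm (1 + v))\<^sup>2 \<le> (1 + norm v)\<^sup>2"
      using norm_triangle_ineq[of 1 v] by (intro power_mono) auto
    have "0 \<le> Re v"
      using v(1) \<delta> by (smt (verit) mult_nonneg_nonneg norm_ge_zero)
    then show "0 \<le> Re v + (norm v)\<^sup>2"
      by simp
  qed (use v in auto)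
  finally show ?thesis
    using False eq by (simp add: D_def dLg_def v_def)
qed (use \<delta> in \<open>simp add: D_def dLg_def\<close>)

section \<open>Summation over the factors\<close>

lemma summable_w: "summable (\<lambda>n. norm (w n t))"
proof -
  have "summable (\<lambda>n. exp (Re t) * (1 / norm (b n)))"
    by (intro summable_mult summable_b)
  then show ?thesis
    by (simp add: norm_w)
qed

lemma summable_D: "summable (\<lambda>n. D n k)"
proof (rule summable_comparison_test'[OF summable_w[of "y k"], of N])
  fix n assume "N \<le> n"
  moreover have "norm (w n (y k)) / (1 + norm (w n (y k))) \<le> norm (w n (y k)) / 1"
    by (intro divide_left_mono) (auto intro!: add_pos_nonneg)
  ultimately show "norm (D n k) \<le> norm (w n (y k))"
    by (simp add: D_def)
qed

lemma summable_dLg: "summable (\<lambda>n. dLg n k)"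
proof (rule summable_comparison_test'[OF summable_w[of "y k"], of N])
  fix n assume n: "N \<le> n"
  have "norm (w n (y k)) / norm (1 + w n (y k)) \<le> norm (w n (y k)) / 1"
    using Re_w_ge(4)[OF n, of "y k"] cball_y(1)[OF y_in_cball, of k] by (intro divide_left_mono) auto
  then show "norm (dLg n k) \<le> norm (w n (y k))"
    using n by (simp add: dLg_def norm_divide)
qed

lemma summable_Lg:
  assumes "t \<in> cball (y k) \<rho>"
  shows "summable (\<lambda>n. Lg n t)"
proof (rule summable_comparison_test'[OF summable_mult[OF summable_w[of t], of 2], of N])
  fix n assume n: "N \<le> n"
  have "norm (Ln (1 + w n t) - Ln (1 + 0)) \<le> 2 * norm (w n t - 0)"
    using Re_w_ge(2)[OF n cball_y(1)[OF assms]] by (intro norm_Ln_1_plus_diff_le) auto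
  then show "norm (Lg n t) \<le> 2 * norm (w n t)"
    using n by (simp add: Lg_def)
qed

lemma Re_A_ge: "\<delta> * (\<Sum>n. D n k) \<le> Re (A k)"
proof -
  have "\<delta> * (\<Sum>n. D n k) = (\<Sum>n. \<delta> * D n k)"
    by (rule suminf_mult[OF summable_D, symmetric])
  also have "\<dots> \<le> (\<Sum>n. Re (dLg n k))"
    using summable_D summable_dLg by (intro suminf_le Re_dLg_ge summable_mult summable_Re)
  also have "\<dots> = Re (\<Sum>n. dLg n k)"
    using summable_dLg by (rule Re_suminf[symmetric])
  finally show ?thesis
    by (simp add: A_def)
qed

text \<open>Error and derivative are both measured by the sum of the \<open>D n k\<close>: the error
  with the factor \<open>4 * \<rho> \<le> \<delta> / 4\<close>, the derivative with at least
  \<delta>.\<close>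

lemma near_linear_F:
  assumes k: "large k" and t: "t \<in> cball (y k) \<rho>" and u: "u \<in> cball (y k) \<rho>"
  shows "norm (F t - F u - A k * (t - u)) \<le> 1/2 * norm (A k) * norm (t - u)"
proof -
  have "(\<lambda>n. Lg n t - Lg n u - dLg n k * (t - u)) sums
      ((\<Sum>n. Lg n t) - (\<Sum>n. Lg n u) - (\<Sum>n. dLg n k) * (t - u))"
    using summable_Lg[OF t] summable_Lg[OF u] summable_dLg[of k]
    by (intro sums_diff sums_mult2 summable_sums)
  then have sums: "(\<lambda>n. Lg n t - Lg n u - dLg n k * (t - u)) sums (F t - F u - A k * (t - u))"
    by (simp add: F_def A_def algebra_simps)
  have "norm (F t - F u - A k * (t - u)) \<le> (\<Sum>n. 4 * \<rho> * D n k * norm (t - u))"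
    using sums near_linear_Lg[OF k t u] summable_D
    by (subst sums_unique[OF sums]) (intro norm_suminf_le summable_mult2 summable_mult)
  also have "\<dots> = 4 * \<rho> * (\<Sum>n. D n k) * norm (t - u)"
    using summable_D by (simp add: suminf_mult suminf_mult2[symmetric] summable_mult)
  also have "\<dots> \<le> 1/2 * norm (A k) * norm (t - u)"
  proof (rule mult_right_mono)
    have "4 * \<rho> * (\<Sum>n. D n k) \<le> \<delta> / 4 * (\<Sum>n. D n k)"
      using \<rho> summable_D D_nonneg by (intro mult_right_mono suminf_nonneg) auto
    also have "\<dots> \<le> Re (A k) / 4"
      using Re_A_ge[of k] by simp
    also have "\<dots> \<le> 1/2 * norm (A k)"
      using complex_Re_le_cmod[of "A k"] norm_ge_zero[of "A k"] by linarith
    finally show "4 * \<rho> * (\<Sum>n. D n k) \<le> 1/2 * norm (A k)" .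
  qed auto
  finally show ?thesis .
qed

lemma exp_F:
  assumes k: "large k" and t: "t \<in> cball (y k) \<rho>"
  shows "f (exp t) = exp (F t)"
proof -
  have "exp (\<Sum>n. Lg n t) = (\<Prod>n. exp (Lg n t))"
    by (rule prodinf_exp[OF summable_Lg[OF t], symmetric])
  also have "\<dots> = (\<Prod>n. 1 + exp t / b n)"
    using exp_Lg[OF k t] by simp
  finally show ?thesis
    using c by (simp add: F_def f_eq exp_add exp_of_nat_mult)
qed

section \<open>Behaviour far to the right and the choice of constants\<close>

lemma eventually_norm_A_ge: "eventually (\<lambda>k. B \<le> norm (A k)) at_top"
proof -
  \<comment> \<open>Each \<open>b n\<close> of modulus at most \<open>exp k\<close> contributes at
    least 1/2 to the sum of the \<open>D n k\<close>, hence \<open>m\<close> of them give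
    \<open>\<delta> * m / 2 \<ge> B\<close>.\<close>
  define m where "m = nat \<lceil>2 * B / \<delta>\<rceil>"
  have "2 * B / \<delta> \<le> real m"
    unfolding m_def by linarith
  then have m: "B \<le> \<delta> * (real m / 2)"
    using \<delta> by (simp add: field_simps)
  have "eventually (\<lambda>k :: int. \<forall>n<m. norm (b n) \<le> exp (of_int k)) at_top"
    by (rule eventually_compose_filterlim[OF eventually_large])
      (intro filterlim_compose[OF exp_at_top] filterlim_real_of_int_at_top)
  then show ?thesis
  proof eventually_elim
    case (elim k)
    have "1 / 2 \<le> D n k" if "n < m" for n
    proof -
      have "1 \<le> norm (w n (y k))"
        using elim that b[of n] by (simp add: norm_w y_def)
      then show ?thesis
        by (simp add: D_def field_simps)
    qed
    then have "(\<Sum>n<m. 1 / 2) \<le> (\<Sum>n<m. D n k)"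
      by (intro sum_mono) auto
    also have "\<dots> \<le> (\<Sum>n. D n k)"
      by (intro sum_le_suminf summable_D D_nonneg) auto
    finally have "\<delta> * (real m / 2) \<le> \<delta> * (\<Sum>n. D n k)"
      using \<delta> by (intro mult_left_mono) auto
    also have "\<dots> \<le> norm (A k)"
      using Re_A_ge[of k] complex_Re_le_cmod[of "A k"] by linarith
    finally show ?case
      using m by linarith
  qed
qed

lemma eventually_large_index: "eventually large at_top"
proof -
  have "eventually (\<lambda>k :: int. \<forall>n<N. norm (b n) \<le> \<rho> * exp (of_int k - 1)) at_top"
  proof (rule eventually_compose_filterlim[OF eventually_large])
    have "filterlim (\<lambda>x :: real. \<rho> * exp (x - 1)) at_top at_top"
      using \<rho>(1) by real_asymp
    then show "filterlim (\<lambda>k :: int. \<rho> * exp (of_int k - 1)) at_top at_top"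
      by (rule filterlim_compose) (rule filterlim_real_of_int_at_top)
  qed
  then show ?thesis
    by (simp add: large_def[abs_def])
qed

text \<open>The growth \<open>r < P (r / K)\<close> at \<open>r = exp k\<close> bounds
  \<open>norm (f (exp (y k)))\<close> from below, and its logarithm is
  \<open>Re (F (y k))\<close>.\<close>

lemma eventually_Re_F_ge: "eventually (\<lambda>k. of_int k \<le> Re (F (y k))) at_top"
proof -
  have "eventually (\<lambda>k :: int. exp (of_int k) < P (exp (of_int k) / K)) at_top"
    by (rule eventually_compose_filterlim[OF eventually_P_gt])
      (intro filterlim_compose[OF exp_at_top] filterlim_real_of_int_at_top)
  then show ?thesis
    using eventually_large_index
  proof eventually_elim
    case (elim k)
    have "4 * norm (b n) \<le> exp (of_int k)" if n: "n < N" for n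
    proof -
      have "norm (b n) \<le> \<rho> * exp (of_int k)"
        using small_of_large[OF elim(2) n y_in_cball] by (simp add: norm_mult norm_divide exp_minus y_def field_simps)
      also have "\<dots> \<le> 1/16 * exp (of_int k)"
        using \<rho>_le by (intro mult_right_mono) auto
      finally show ?thesis
        using exp_ge_zero[of "of_int k :: real"] by linarith
    qed
    then have "P (exp (of_int k) / K) \<le> norm (f (exp (y k)))"
      using P_le_norm_f[of "y k"] \<rho> by (simp add: y_def)
    also have "\<dots> = exp (Re (F (y k)))"
      using exp_F[OF elim(2) y_in_cball] by simp
    finally have "exp (of_int k) < exp (Re (F (y k)))"
      using elim(1) by linarith
    then show ?case
      by simp
  qed
qed

lemma hausdorff_dim_fast_escaping: "hausdorff_dim (fast_escaping_set f) = 2"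
proof (rule hausdorff_dim_eq_2I)
  fix s :: real assume s: "0 < s" "s < 2"
  obtain R0 where R0: "R0 > 0"
    "\<And>z. (\<And>i. \<exists>t. (f ^^ i) z = exp t \<and> \<bar>Im t - \<phi>\<bar> \<le> \<rho> \<and> R0 \<le> exp (Re t)) \<Longrightarrow> z \<in> fast_escaping_set f"
    using exists_escape_radius by blast
  \<comment> \<open>The first bound makes images large against the lattice, the second pays for the
    distortion at exponent \<open>s\<close>. The second is unbounded as \<open>s\<close> approaches
    2, so \<open>B\<close> and \<open>k0\<close> depend on \<open>s\<close>.\<close>
  define B where "B = max (48 / \<rho>) ((33000 / \<rho>\<^sup>2) powr (1 / (2 - s)))"
  have "33000 / \<rho>\<^sup>2 = ((33000 / \<rho>\<^sup>2) powr (1 / (2 - s))) powr (2 - s)"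
    using s \<rho> by (simp add: powr_powr)
  also have "\<dots> \<le> B powr (2 - s)"
    using s by (intro powr_mono2) (auto simp: B_def)
  finally have Bs: "33000 / \<rho>\<^sup>2 \<le> B powr (2 - s)" .
  have "eventually (\<lambda>k. large k \<and> B \<le> norm (A k) \<and> of_int k \<le> Re (F (y k)) \<and> \<lceil>ln R0\<rceil> + 1 \<le> k) at_top"
    by (intro eventually_conj eventually_large_index eventually_norm_A_ge eventually_Re_F_ge eventually_ge_at_top)
  then obtain k0 where k0: "\<And>k. k0 \<le> k \<Longrightarrow> large k" "\<And>k. k0 \<le> k \<Longrightarrow> B \<le> norm (A k)"
      "\<And>k. k0 \<le> k \<Longrightarrow> of_int k \<le> Re (F (y k))" "\<And>k. k0 \<le> k \<Longrightarrow> \<lceil>ln R0\<rceil> + 1 \<le> k"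
    unfolding eventually_at_top_linorder by blast
  interpret E: expanding_strip F \<phi> \<rho> B k0 A
  proof
    show "0 < \<rho>" "\<rho> \<le> 1/4"
      using \<rho> \<rho>_le by auto
    show "48 / \<rho> \<le> B"
      by (simp add: B_def)
  qed (use k0 near_linear_F in \<open>auto simp: y_def\<close>)
  have y: "E.y = y"
    by (simp add: fun_eq_iff E.y_def y_def)
  show "hausdorff_measure s (fast_escaping_set f) \<noteq> 0"
  proof (rule E.hausdorff_measure_neq_0[OF s Bs, of f])
    show "f (exp t) = exp (F t)" if "k0 \<le> k" "t \<in> cball (E.y k) \<rho>" for k t
      using exp_F[OF k0(1)[OF that(1)], of t] that(2) by (simp add: y)
    fix z assume z: "\<And>i. \<exists>j\<ge>k0. \<exists>u\<in>cball (E.y j) \<rho>. (f ^^ i) z = exp u"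
    show "z \<in> fast_escaping_set f"
    proof (rule R0(2))
      fix i
      obtain j u where u: "k0 \<le> j" "u \<in> cball (y j) \<rho>" "(f ^^ i) z = exp u"
        using z[of i] by (auto simp: y)
      have "ln R0 \<le> Re u"
        using k0(4)[OF u(1)] cball_y(2)[OF u(2)] by linarith
      then have "exp (ln R0) \<le> exp (Re u)"
        by (simp only: exp_le_cancel_iff)
      then have "R0 \<le> exp (Re u)"
        using R0(1) by simp
      then show "\<exists>t. (f ^^ i) z = exp t \<and> \<bar>Im t - \<phi>\<bar> \<le> \<rho> \<and> R0 \<le> exp (Re t)"
        using u cball_y(1)[OF u(2)] by blast
    qed
  qed
qed

end

theorem corollary1p1:
  fixes f :: "complex \<Rightarrow> complex"
    and c :: complex
    and q :: nat
    and a :: "nat \<Rightarrow> complex"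
    and \<theta>\<^sub>1 \<theta>\<^sub>2 :: real
    and N\<^sub>0 :: nat
  assumes "transcendental_entire f"
    and "c \<noteq> 0"
    and "0 < norm (a 1)"
    and "\<And>m n. 1 \<le> m \<Longrightarrow> m \<le> n \<Longrightarrow> norm (a m) \<le> norm (a n)"
    and genus_zero: "summable (\<lambda>n. 1 / norm (a (Suc n)))"
    and "\<And>z. f z = c * z ^ q * (\<Prod>n. 1 + z / a (Suc n))"
    and "0 < \<theta>\<^sub>1" and "0 < \<theta>\<^sub>2"
    and "0 \<le> \<theta>\<^sub>2 - \<theta>\<^sub>1" and "\<theta>\<^sub>2 - \<theta>\<^sub>1 < pi"
    and "\<And>n. 1 \<le> n \<Longrightarrow> N\<^sub>0 \<le> n \<Longrightarrow>
           \<exists>k::int. Arg (a n) + 2 * pi * of_int k \<in> {\<theta>\<^sub>1..\<theta>\<^sub>2}"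
  shows "hausdorff_dim (fast_escaping_set f) = 2"
proof -
  \<comment> \<open>\<phi> bisects the range of arguments, and \<beta> is half its opening, less
    than a right angle.\<close>
  define \<phi> \<beta> where "\<phi> = (\<theta>\<^sub>1 + \<theta>\<^sub>2) / 2" and "\<beta> = (\<theta>\<^sub>2 - \<theta>\<^sub>1) / 2"
  have \<beta>: "0 \<le> \<beta>" "\<beta> < pi / 2"
    using assms by (auto simp: \<beta>_def)
  \<comment> \<open>Halfway between \<beta> and a right angle: this leaves room for the strip of
    half-width \<rho>, over which the arguments of the quotients stay within \<gamma>, while
    \<open>cos \<gamma>\<close> is still positive.\<close>
  define \<gamma> where "\<gamma> = (\<beta> + pi / 2) / 2"
  have \<gamma>: "\<beta> < \<gamma>" "0 < \<gamma>" "\<gamma> < pi / 2"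
    using \<beta> by (auto simp: \<gamma>_def)
  define \<delta> where "\<delta> = cos \<gamma>"
  have \<delta>: "0 < \<delta>" "\<delta> \<le> 1"
    using \<gamma> by (auto simp: \<delta>_def intro: cos_gt_zero)
  define \<rho> where "\<rho> = min (\<delta> / 16) (\<gamma> - \<beta>)"
  have \<rho>: "0 < \<rho>" "\<rho> \<le> \<delta> / 16" "\<beta> + \<rho> \<le> \<gamma>"
    using \<delta> \<gamma> unfolding \<rho>_def by linarith+
  have a_pos: "0 < norm (a (Suc n))" for n
    by (rule less_le_trans[OF assms(3) assms(4)]) simp_all
  interpret genus_zero_sector f c q "\<lambda>n. a (Suc n)" \<phi> \<rho> \<delta> N\<^sub>0
  proof
    show "c \<noteq> 0" "summable (\<lambda>n. 1 / norm (a (Suc n)))"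
      by (rule assms)+
    show "f z = c * z ^ q * (\<Prod>n. 1 + z / a (Suc n))" for z
      by (rule assms)
    show "f holomorphic_on UNIV"
      using assms(1) by (simp add: transcendental_entire_def)
    show "a (Suc n) \<noteq> 0" for n
      using a_pos[of n] by auto
    fix n and t :: complex assume n: "N\<^sub>0 \<le> n" and t: "\<bar>Im t - \<phi>\<bar> \<le> \<rho>"
    obtain k :: int where k: "Arg (a (Suc n)) + 2 * pi * of_int k \<in> {\<theta>\<^sub>1..\<theta>\<^sub>2}"
      using assms(11)[of "Suc n"] n by auto
    define \<alpha> where "\<alpha> = Arg (a (Suc n)) + 2 * pi * of_int k"
    have "\<bar>\<alpha> - \<phi>\<bar> \<le> \<beta>"
      using k unfolding \<alpha>_def[symmetric] by (auto simp: \<phi>_def \<beta>_def abs_le_iff field_simps)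
    then have "\<bar>Im t - \<alpha>\<bar> \<le> \<gamma>"
      using t \<rho>(3) by linarith
    then have "cos \<gamma> \<le> cos \<bar>Im t - \<alpha>\<bar>"
      using \<gamma> by (intro cos_monotone_0_pi_le) auto
    then have cos: "\<delta> \<le> cos (Im t - \<alpha>)"
      by (simp add: \<delta>_def)
    have "cis \<alpha> = cis (Arg (a (Suc n)))"
      using cis_multiple_2pi[of "of_int k"] by (simp add: \<alpha>_def cis_mult[symmetric])
    then have "a (Suc n) = of_real (norm (a (Suc n))) * cis \<alpha>"
      using a_pos[of n] by (simp add: cis_Arg sgn_eq)
    then have "exp t / a (Suc n) = (of_real (exp (Re t)) * cis (Im t)) / (of_real (norm (a (Suc n))) * cis \<alpha>)"
      by (simp add: exp_eq_polar)
    also have "\<dots> = of_real (exp (Re t) / norm (a (Suc n))) * cis (Im t - \<alpha>)"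
      by (simp flip: cis_divide)
    finally have "exp t / a (Suc n) = of_real (exp (Re t) / norm (a (Suc n))) * cis (Im t - \<alpha>)" .
    then have "Re (exp t / a (Suc n)) = cos (Im t - \<alpha>) * norm (exp t / a (Suc n))"
      by (simp add: norm_mult norm_divide)
    then show "\<delta> * norm (exp t / a (Suc n)) \<le> Re (exp t / a (Suc n))"
      using cos by (simp add: mult_right_mono)
  qed (use \<delta> \<rho> in auto)
  show ?thesis
    by (rule hausdorff_dim_fast_escaping)
qed

end
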